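(* Let $f, g_i, h_j \in C^{1,1}(\mathbb{R}^n)$ for $i\in I=\{1,\dots,m\}$, $j\in J=\{1,\dots,p\}$, and consider the problem (P1) of minimizing $f(x)$ over $x\in X:=\{x\in\mathbb{R}^n\mid g_i(x)\le 0,\ i\in I,\ h_j(x)=0,\ j\in J\}$. Suppose that $\bar x\in X$ is a local solution of (P1) and that the MSCQ holds at $\bar x$. Then the following assertions hold: (i) $\langle\nabla f(\bar x), v\rangle\ge 0$ for any $v\in T(\bar x,X)$. Consequently, $\Lambda(\bar x)$ is nonempty. (ii) Let $(\bar\lambda,\bar\mu)\in\Lambda(\bar x)$. Then for each $v\in T(\bar x,X^0)$ there exists $z\in\partial^2\mathcal{L}(\bar x,\bar\lambda,\bar\mu)(v)$ such that $\langle z,v\rangle\ge 0$, where $$X^0=\{x\in\mathbb{R}^n\mid h_j(x)=0,\ j\in J,\ \ g_i(x)=0 \text{ if } i\in I^0(\bar x)\text{ and }\bar\lambda_i>0,\ \ g_i(x)\le 0\text{ otherwise}\}.$$ (iii) If $\bar x$ is an isolated local solution of order $2$ of (P1) and $(\bar\lambda,\bar\mu)\in\Lambda(\bar x)$, then, with $X^0$ the set defined in (ii) from $(\bar\lambda,\bar\mu)$, for every $v\in T(\bar x,X^0)\setminus\{0\}$ there exists $z\in\partial^2\mathcal{L}(\bar x,\bar\lambda,\bar\mu)(v)$ such that $\langle z,v\rangle>0$.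
   Context: All spaces are finite-dimensional Euclidean spaces with inner product $\langle\cdot,\cdot\rangle$ and norm $\|\cdot\|$. $C^{1,1}(\mathbb{R}^n)$ is the class of real-valued Fréchet differentiable functions on $\mathbb{R}^n$ whose gradient mapping is locally Lipschitz. Active index set: $I^0(x):=\{i\in I\mid g_i(x)=0\}$. Contingent cone: for $\Omega\subset\mathbb{R}^n$ and $\bar x\in\Omega$, $v\in T(\bar x,\Omega)$ iff there exist $t_k\to0^+$ (with $t_k>0$) and $v_k\to v$ such that $\bar x+t_kv_k\in\Omega$ for every $k\in\mathbb{N}$. MSCQ (metric subregularity constraint qualification) at $\bar x\in X$: there exist a neighborhood $U$ of $\bar x$ and $\kappa>0$ such that $$\mathrm{dist}(x;X)\le\kappa\Big(\sum_{i\in I}\max\{g_i(x),0\}+\sum_{j\in J}|h_j(x)|\Big)\quad\text{for all }x\in U.$$ Lagrangian: $\mathcal{L}(x,\lambda,\mu)=f(x)+\sum_{i\in I}\lambda_ig_i(x)+\sum_{j\in J}\mu_jh_j(x)$. Set of Lagrange multipliers at $\bar x\in X$: $$\Lambda(\bar x):=\{(\bar\lambda,\bar\mu)\in\mathbb{R}^m_+\times\mathbb{R}^p\mid\nabla_x\mathcal{L}(\bar x,\bar\lambda,\bar\mu)=0,\ \bar\lambda_ig_i(\bar x)=0,\ i\in I\}.$$ Isolated local solution of order 2: a point $\bar x\in X$ for which there exist $\rho>0$ and a neighborhood $U$ of $\bar x$ such that $f(x)>f(\bar x)+\frac12\rho\|x-\bar x\|^2$ for all $x\in X\cap U$, $x\ne\bar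 x$. Normal cones: for $\Omega\subset\mathbb{R}^n$ and $\bar x\in\Omega$, the Fréchet normal cone is $\widehat N(\bar x,\Omega)=\{v\mid\limsup_{x\to\bar x,\,x\in\Omega}\langle v,x-\bar x\rangle/\|x-\bar x\|\le0\}$, and the limiting (Mordukhovich) normal cone $N(\bar x,\Omega)$ is the set of all $v$ for which there exist $x_k\to\bar x$, $x_k\in\Omega$, and $v_k\in\widehat N(x_k,\Omega)$ with $v_k\to v$. Limiting second-order subdifferential: for $\phi\in C^{1,1}(\mathbb{R}^n)$ (so that the limiting subdifferential $\partial\phi(x)$ equals $\{\nabla\phi(x)\}$), it is the limiting coderivative of the gradient mapping: $$\partial^2\phi(\bar x)(v)=\{u\in\mathbb{R}^n\mid(u,-v)\in N((\bar x,\nabla\phi(\bar x)),\mathrm{gph}\,\nabla\phi)\},\quad v\in\mathbb{R}^n.$$ $\partial^2\mathcal{L}(\bar x,\bar\lambda,\bar\mu)(v)$ denotes the limiting second-order subdifferential at $\bar x$ of the function $x\mapsto\mathcal{L}(x,\bar\lambda,\bar\mu)$, evaluated at $v$. *)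

theory Defs
  imports "HOL-Analysis.Analysis"
begin

text \<open>The unique gradient vector; meaningful only where \<open>f\<close> is Frechet differentiable.\<close>
definition gradient :: "('a::euclidean_space \<Rightarrow> real) \<Rightarrow> 'a \<Rightarrow> 'a" where
  "gradient f x = (THE D. GDERIV f x :> D)"

definition C11 :: "('a::euclidean_space \<Rightarrow> real) \<Rightarrow> bool" where
  "C11 f \<longleftrightarrow> (\<forall>x. f differentiable (at x)) \<and>
     (\<forall>x. \<exists>r>0. \<exists>L. L-lipschitz_on (cball x r) (gradient f))"

definition contingent_cone :: "'a::euclidean_space \<Rightarrow> 'a set \<Rightarrow> 'a set" where
  "contingent_cone xbar \<Omega> =
     {v. \<exists>t w. (\<forall>k::nat. 0 < t k) \<and> t \<longlonglongrightarrow> (0::real) \<and> w \<longlonglongrightarrow> v \<and>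
           (\<forall>k. xbar + t k *\<^sub>R w k \<in> \<Omega>)}"

text \<open>At an isolated point of \<open>\<Omega>\<close> the filter below is trivial, the upper limit is \<open>-\<infinity>\<close>,
  and the cone is the whole space, as usual.\<close>
definition frechet_normal_cone :: "'a::euclidean_space \<Rightarrow> 'a set \<Rightarrow> 'a set" where
  "frechet_normal_cone xbar \<Omega> =
     {v. Limsup (at xbar within \<Omega>) (\<lambda>x. ereal (v \<bullet> (x - xbar) / norm (x - xbar))) \<le> 0}"

definition limiting_normal_cone :: "'a::euclidean_space \<Rightarrow> 'a set \<Rightarrow> 'a set" where
  "limiting_normal_cone xbar \<Omega> =
     {v. \<exists>x w. x \<longlonglongrightarrow> xbar \<and> w \<longlonglongrightarrow> v \<and>
           (\<forall>k::nat. x k \<in> \<Omega> \<and> w k \<in> frechet_normal_cone (x k) \<Omega>)}"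

text \<open>Limiting coderivative of the gradient mapping; the graph lives in the product space
  \<open>'a \<times> 'a\<close> with its Euclidean structure. Intended for \<open>C11 \<phi>\<close>.\<close>
definition second_subdiff :: "('a::euclidean_space \<Rightarrow> real) \<Rightarrow> 'a \<Rightarrow> 'a \<Rightarrow> 'a set" where
  "second_subdiff \<phi> xbar v =
     {u. (u, - v) \<in> limiting_normal_cone (xbar, gradient \<phi> xbar) (range (\<lambda>x. (x, gradient \<phi> x)))}"

text \<open>Problem data: the constraint functions are \<open>g 1, \<dots>, g m\<close> and \<open>h 1, \<dots>, h p\<close>, where
  \<open>m = 0\<close> or \<open>p = 0\<close> is permitted. Values of \<open>g\<close> and \<open>h\<close> at other indices are never used.\<close>

definition feasible_set ::
  "nat \<Rightarrow> nat \<Rightarrow> (nat \<Rightarrow> 'a::euclidean_space \<Rightarrow> real) \<Rightarrow> (nat \<Rightarrow> 'a \<Rightarrow> real) \<Rightarrow> 'a set" where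
  "feasible_set m p g h = {x. (\<forall>i\<in>{1..m}. g i x \<le> 0) \<and> (\<forall>j\<in>{1..p}. h j x = 0)}"

definition active_set :: "nat \<Rightarrow> (nat \<Rightarrow> 'a::euclidean_space \<Rightarrow> real) \<Rightarrow> 'a \<Rightarrow> nat set" where
  "active_set m g x = {i\<in>{1..m}. g i x = 0}"

definition MSCQ ::
  "nat \<Rightarrow> nat \<Rightarrow> (nat \<Rightarrow> 'a::euclidean_space \<Rightarrow> real) \<Rightarrow> (nat \<Rightarrow> 'a \<Rightarrow> real) \<Rightarrow> 'a \<Rightarrow> bool" where
  "MSCQ m p g h xbar \<longleftrightarrow>
     (\<exists>U \<kappa>. open U \<and> xbar \<in> U \<and> \<kappa> > 0 \<and>
        (\<forall>x\<in>U. infdist x (feasible_set m p g h)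
               \<le> \<kappa> * ((\<Sum>i\<in>{1..m}. max (g i x) 0) + (\<Sum>j\<in>{1..p}. \<bar>h j x\<bar>))))"

definition local_solution :: "('a::euclidean_space \<Rightarrow> real) \<Rightarrow> 'a set \<Rightarrow> 'a \<Rightarrow> bool" where
  "local_solution f X xbar \<longleftrightarrow>
     xbar \<in> X \<and> (\<exists>U. open U \<and> xbar \<in> U \<and> (\<forall>x\<in>X \<inter> U. f xbar \<le> f x))"

definition isolated_local_solution2 :: "('a::euclidean_space \<Rightarrow> real) \<Rightarrow> 'a set \<Rightarrow> 'a \<Rightarrow> bool" where
  "isolated_local_solution2 f X xbar \<longleftrightarrow>
     xbar \<in> X \<and> (\<exists>\<rho> U. \<rho> > 0 \<and> open U \<and> xbar \<in> U \<and>
        (\<forall>x\<in>X \<inter> U. x \<noteq> xbar \<longrightarrow> f x > f xbar + 1/2 * \<rho> * (norm (x - xbar))\<^sup>2))"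

definition lagrangian ::
  "nat \<Rightarrow> nat \<Rightarrow> ('a::euclidean_space \<Rightarrow> real) \<Rightarrow> (nat \<Rightarrow> 'a \<Rightarrow> real) \<Rightarrow> (nat \<Rightarrow> 'a \<Rightarrow> real)
     \<Rightarrow> 'a \<Rightarrow> (nat \<Rightarrow> real) \<Rightarrow> (nat \<Rightarrow> real) \<Rightarrow> real" where
  "lagrangian m p f g h x lam mu =
     f x + (\<Sum>i\<in>{1..m}. lam i * g i x) + (\<Sum>j\<in>{1..p}. mu j * h j x)"

text \<open>Vectors of \<open>m\<close> (resp. \<open>p\<close>) reals are represented by extensional functions on
  \<open>{1..m}\<close> (resp. \<open>{1..p}\<close>).\<close>
definition multipliers ::
  "nat \<Rightarrow> nat \<Rightarrow> ('a::euclidean_space \<Rightarrow> real) \<Rightarrow> (nat \<Rightarrow> 'a \<Rightarrow> real) \<Rightarrow> (nat \<Rightarrow> 'a \<Rightarrow> real)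
     \<Rightarrow> 'a \<Rightarrow> ((nat \<Rightarrow> real) \<times> (nat \<Rightarrow> real)) set" where
  "multipliers m p f g h xbar =
     {(lam, mu). lam \<in> {1..m} \<rightarrow>\<^sub>E {0..} \<and> mu \<in> {1..p} \<rightarrow>\<^sub>E UNIV \<and>
        gradient (\<lambda>x. lagrangian m p f g h x lam mu) xbar = 0 \<and>
        (\<forall>i\<in>{1..m}. lam i * g i xbar = 0)}"

definition X0_set ::
  "nat \<Rightarrow> nat \<Rightarrow> (nat \<Rightarrow> 'a::euclidean_space \<Rightarrow> real) \<Rightarrow> (nat \<Rightarrow> 'a \<Rightarrow> real)
     \<Rightarrow> 'a \<Rightarrow> (nat \<Rightarrow> real) \<Rightarrow> 'a set" where
  "X0_set m p g h xbar lam =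
     {x. (\<forall>j\<in>{1..p}. h j x = 0) \<and>
         (\<forall>i\<in>{1..m}. if i \<in> active_set m g xbar \<and> lam i > 0 then g i x = 0 else g i x \<le> 0)}"

end

theory Submission
  imports Defs
begin

text \<open>
  First-order part. A difference quotient of \<open>f\<close> along a feasible sequence is nonnegative at a
  local solution, so the gradient of \<open>f\<close> is nonnegative on the contingent cone. The metric
  subregularity condition makes the contingent cone contain all solutions of the linearized
  constraints (lemma \<open>MSCQ_linearized_subset_contingent\<close>): moving from \<open>xbar\<close> by \<open>t v\<close> with such a
  \<open>v\<close> violates the constraints by \<open>o(t)\<close> only, hence some feasible point lies within \<open>o(t)\<close>.
  Multipliers are then supplied by Farkas' lemma (\<open>farkas_mixed\<close>).

  Second-order part. Let \<open>\<phi>\<close> be the Lagrangian for a fixed multiplier and \<open>F\<close> its gradient, so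
  \<open>F xbar = 0\<close>. On \<open>X0\<close> all terms of \<open>\<phi>\<close> other than \<open>f\<close> vanish and \<open>X0\<close> is contained in the feasible
  set, so a growth condition of \<open>f\<close> with modulus \<open>\<rho> \<ge> 0\<close> (where \<open>\<rho> = 0\<close> is local
  optimality) gives \<open>\<phi> (xbar + t w) \<ge> \<phi> xbar + \<rho>/2 (t \<bar>w\<bar>)\<^sup>2\<close> along the sequences \<open>t\<close>, \<open>w\<close> which
  define a contingent direction \<open>v\<close>. The task is to turn this into an element \<open>z\<close> of the limiting
  coderivative of \<open>F\<close> in direction \<open>v\<close> with \<open>z \<bullet> v \<ge> \<rho> \<bar>v\<bar>\<^sup>2\<close>.

  By the mean value theorem the locally Lipschitz function \<open>\<theta> y = w \<bullet> F y\<close>, which vanishes at \<open>xbar\<close>, is at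
  least \<open>\<rho> c \<bar>w\<bar>\<^sup>2\<close> at some \<open>xbar + c w\<close> with \<open>0 < c < t\<close>. If \<open>\<theta>\<close> were
  differentiable, its derivative along \<open>w\<close> would be at least \<open>\<rho> \<bar>w\<bar>\<^sup>2\<close> at some point of the segment.
  For a function that is merely locally Lipschitz an approximate version is proved in two steps:
  on the segment, \<open>\<theta>\<close> has a supporting parabola at an interior point with slope at least \<open>\<rho> \<bar>w\<bar>\<^sup>2 - \<epsilon>\<close> (\<open>touching_parabola\<close>), and a
  quadratic penalty on the distance to the line turns this into a proximal subgradient \<open>\<zeta>\<close> of \<open>\<theta>\<close> at
  a nearby point of the whole space with almost the same value of \<open>\<zeta> \<bullet> w\<close>
  (\<open>proximal_subgradient_near_line\<close>).

  Proximal subgradients of \<open>w \<bullet> F\<close> are Frechet normals to the graph of \<open>F\<close>: the pair \<open>(\<zeta>, -w)\<close> is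
  one (\<open>scalarized_proximal_subgradient_normal\<close>). As \<open>F\<close> is Lipschitz near \<open>xbar\<close>, the \<open>\<zeta>\<close> are
  bounded, and the limit of a convergent subsequence is the desired \<open>z\<close>
  (\<open>second_subdiff_selection\<close>).
\<close>

section \<open>Gradients of \<open>C11\<close> functions\<close>

text \<open>The Riesz representation of the derivative, obtained as the adjoint evaluated at \<open>1\<close>, provides the
  vector that the definite description in \<open>gradient\<close> asks for.\<close>
lemma has_derivative_gradient:
  fixes f :: "'a::euclidean_space \<Rightarrow> real"
  assumes "f differentiable (at x)"
  shows "(f has_derivative (\<lambda>u. gradient f x \<bullet> u)) (at x)"
proof -
  obtain f' where f': "(f has_derivative f') (at x)"
    using assms by (auto simp: differentiable_def)
  have lin: "linear f'" using f' has_derivative_linear by blast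
  have "f' = (\<lambda>u. u \<bullet> adjoint f' 1)"
    using adjoint_works[OF lin, of _ 1] by (auto simp: inner_commute)
  then have *: "GDERIV f x :> adjoint f' 1" using f' by (simp add: gderiv_def)
  have "D = adjoint f' 1" if "GDERIV f x :> D" for D
  proof -
    have "(\<lambda>u. u \<bullet> D) = (\<lambda>u. u \<bullet> adjoint f' 1)"
      using that * unfolding gderiv_def by (rule has_derivative_unique)
    then have "u \<bullet> (D - adjoint f' 1) = 0" for u by (auto simp: inner_diff_right dest: fun_cong)
    then show ?thesis by (metis eq_iff_diff_eq_0 inner_eq_zero_iff)
  qed
  then have "GDERIV f x :> gradient f x"
    unfolding gradient_def using * by (rule theI[rotated])
  then show ?thesis by (simp add: gderiv_def inner_commute)
qed

lemma gradient_unique: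
  fixes f :: "'a::euclidean_space \<Rightarrow> real"
  assumes "(f has_derivative (\<lambda>u. D \<bullet> u)) (at x)"
  shows "gradient f x = D"
proof -
  have "f differentiable (at x)" using assms by (auto simp: differentiable_def)
  then have "(\<lambda>u. gradient f x \<bullet> u) = (\<lambda>u. D \<bullet> u)"
    using assms has_derivative_gradient has_derivative_unique by blast
  then have "(gradient f x - D) \<bullet> u = 0" for u by (auto simp: inner_diff_left dest: fun_cong)
  then show ?thesis by (metis eq_iff_diff_eq_0 inner_eq_zero_iff)
qed

lemma C11_has_derivative: "C11 f \<Longrightarrow> (f has_derivative (\<lambda>u. gradient f x \<bullet> u)) (at x)"
  by (simp add: C11_def has_derivative_gradient)

lemma C11_local_lipschitz:
  assumes "C11 f"
  obtains r L where "r > 0" "L-lipschitz_on (cball x r) (gradient f)"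
  using assms unfolding C11_def by blast

lemma C11_continuous_gradient:
  assumes "C11 f"
  shows "continuous_on UNIV (gradient f)"
proof (rule continuous_at_imp_continuous_on, rule ballI)
  fix x :: 'a
  obtain r L where "r > 0" "L-lipschitz_on (cball x r) (gradient f)"
    using assms by (rule C11_local_lipschitz)
  then show "isCont (gradient f) x"
    using lipschitz_on_continuous_on continuous_on_interior[of "cball x r"]
    by (metis centre_in_ball interior_cball)
qed

lemma C11_add:
  assumes "C11 f" "C11 g"
  shows "C11 (\<lambda>x. f x + g x)"
    and "gradient (\<lambda>x. f x + g x) x = gradient f x + gradient g x"
proof -
  have d: "((\<lambda>x. f x + g x) has_derivative (\<lambda>u. (gradient f x + gradient g x) \<bullet> u)) (at x)" for x
    unfolding inner_add_left by (intro has_derivative_add C11_has_derivative assms)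
  show gr: "gradient (\<lambda>x. f x + g x) x = gradient f x + gradient g x" for x
    by (rule gradient_unique[OF d])
  show "C11 (\<lambda>x. f x + g x)"
    unfolding C11_def
  proof (intro conjI allI)
    show "(\<lambda>x. f x + g x) differentiable at x" for x
      using d by (auto simp: differentiable_def)
    fix x :: 'a
    obtain r L where r: "r > 0" "L-lipschitz_on (cball x r) (gradient f)"
      using assms(1) by (rule C11_local_lipschitz)
    obtain r' L' where r': "r' > 0" "L'-lipschitz_on (cball x r') (gradient g)"
      using assms(2) by (rule C11_local_lipschitz)
    have "(L + L')-lipschitz_on (cball x (min r r')) (\<lambda>x. gradient f x + gradient g x)"
      by (intro lipschitz_on_add lipschitz_on_subset[OF r(2)] lipschitz_on_subset[OF r'(2)]) auto
    moreover have "gradient (\<lambda>x. f x + g x) = (\<lambda>x. gradient f x + gradient g x)"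
      using gr by auto
    ultimately show "\<exists>r>0. \<exists>L. L-lipschitz_on (cball x r) (gradient (\<lambda>x. f x + g x))"
      using r(1) r'(1) by (intro exI[of _ "min r r'"]) auto
  qed
qed

lemma C11_scale:
  fixes f :: "'a::euclidean_space \<Rightarrow> real"
  assumes "C11 f"
  shows "C11 (\<lambda>x. c * f x)" and "gradient (\<lambda>x. c * f x) x = c *\<^sub>R gradient f x"
proof -
  have d: "((\<lambda>x. c * f x) has_derivative (\<lambda>u. (c *\<^sub>R gradient f x) \<bullet> u)) (at x)" for x
    using has_derivative_mult_right[OF C11_has_derivative[OF assms], of c x] by simp
  show gr: "gradient (\<lambda>x. c * f x) x = c *\<^sub>R gradient f x" for x
    by (rule gradient_unique[OF d])
  show "C11 (\<lambda>x. c * f x)"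
    unfolding C11_def
  proof (intro conjI allI)
    show "(\<lambda>x. c * f x) differentiable at x" for x
      using d by (auto simp: differentiable_def)
    fix x :: 'a
    obtain r L where r: "r > 0" "L-lipschitz_on (cball x r) (gradient f)"
      using assms(1) by (rule C11_local_lipschitz)
    have "(\<bar>c\<bar> * L)-lipschitz_on (cball x r) (\<lambda>x. c *\<^sub>R gradient f x)"
      by (rule lipschitz_on_cmult[OF r(2)])
    moreover have "gradient (\<lambda>x. c * f x) = (\<lambda>x. c *\<^sub>R gradient f x)"
      using gr by auto
    ultimately show "\<exists>r>0. \<exists>L. L-lipschitz_on (cball x r) (gradient (\<lambda>x. c * f x))"
      using r(1) by auto
  qed
qed

lemma C11_weighted_sum:
  fixes g :: "'i \<Rightarrow> 'a::euclidean_space \<Rightarrow> real"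
  assumes "finite I" "\<And>i. i \<in> I \<Longrightarrow> C11 (g i)"
  shows "C11 (\<lambda>x. \<Sum>i\<in>I. c i * g i x) \<and>
    gradient (\<lambda>x. \<Sum>i\<in>I. c i * g i x) x = (\<Sum>i\<in>I. c i *\<^sub>R gradient (g i) x)"
  using assms
proof (induction I rule: finite_induct)
  case empty
  have "((\<lambda>x. 0) has_derivative (\<lambda>u. 0 \<bullet> u)) (at x)" for x :: 'a by simp
  then have g0: "gradient (\<lambda>x::'a. 0) x = 0" for x by (rule gradient_unique)
  then have "gradient (\<lambda>x::'a. 0) = (\<lambda>x. 0)" by auto
  then have "0-lipschitz_on (cball x 1) (gradient (\<lambda>x::'a. 0))" for x
    by (simp add: lipschitz_on_constant)
  then have "C11 (\<lambda>x::'a. 0)"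
    unfolding C11_def using zero_less_one by (blast intro: differentiable_const)
  with g0 show ?case by simp
next
  case (insert i I)
  then show ?case
    using C11_add[of "\<lambda>x. c i * g i x" "\<lambda>x. \<Sum>i\<in>I. c i * g i x"] C11_scale[of "g i" "c i"]
    by simp
qed

lemma C11_lagrangian:
  assumes "C11 f" "\<And>i. i \<in> {1..m} \<Longrightarrow> C11 (g i)" "\<And>j. j \<in> {1..p} \<Longrightarrow> C11 (h j)"
  shows "C11 (\<lambda>x. lagrangian m p f g h x lam mu)"
    and "gradient (\<lambda>x. lagrangian m p f g h x lam mu) x =
      gradient f x + (\<Sum>i\<in>{1..m}. lam i *\<^sub>R gradient (g i) x) + (\<Sum>j\<in>{1..p}. mu j *\<^sub>R gradient (h j) x)"
proof -
  note G = C11_weighted_sum[of "{1..m}" g lam] and H = C11_weighted_sum[of "{1..p}" h mu]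
  note fG = C11_add[of f "\<lambda>x. \<Sum>i\<in>{1..m}. lam i * g i x"]
  note fGH = C11_add[of "\<lambda>x. f x + (\<Sum>i\<in>{1..m}. lam i * g i x)" "\<lambda>x. \<Sum>j\<in>{1..p}. mu j * h j x"]
  show "C11 (\<lambda>x. lagrangian m p f g h x lam mu)"
    unfolding lagrangian_def using assms G H fG fGH by simp
  show "gradient (\<lambda>x. lagrangian m p f g h x lam mu) x =
      gradient f x + (\<Sum>i\<in>{1..m}. lam i *\<^sub>R gradient (g i) x) + (\<Sum>j\<in>{1..p}. mu j *\<^sub>R gradient (h j) x)"
    unfolding lagrangian_def using assms G H fG fGH by simp
qed

section \<open>Proximal subgradients and Frechet normals to graphs\<close>

text \<open>Local support from below by a quadratic function. The constant \<open>M\<close> may have any size, so adding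
  a smooth quadratic to \<open>\<theta>\<close> just shifts the subgradients by its gradient.\<close>
definition proximal_subgradient :: "('a::euclidean_space \<Rightarrow> real) \<Rightarrow> 'a \<Rightarrow> 'a \<Rightarrow> bool" where
  "proximal_subgradient \<theta> x \<zeta> \<longleftrightarrow>
     (\<exists>M. \<forall>\<^sub>F x' in nhds x. \<theta> x' \<ge> \<theta> x + \<zeta> \<bullet> (x' - x) - M * (norm (x' - x))\<^sup>2)"

text \<open>Compare the two bounds on \<open>\<theta>\<close> at the points \<open>x + \<tau> \<zeta>\<close>, divide by \<open>\<tau>\<close> and let \<open>\<tau>\<close> tend to \<open>0\<close>.\<close>
lemma proximal_subgradient_norm_le:
  fixes \<theta> :: "'a::euclidean_space \<Rightarrow> real"
  assumes prox: "proximal_subgradient \<theta> x \<zeta>" and L: "L \<ge> 0"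
    and lip: "\<forall>\<^sub>F x' in nhds x. \<theta> x' \<le> \<theta> x + L * norm (x' - x)"
  shows "norm \<zeta> \<le> L"
proof (cases "\<zeta> = 0")
  case True
  then show ?thesis using L by simp
next
  case False
  obtain M where M: "\<forall>\<^sub>F x' in nhds x. \<theta> x' \<ge> \<theta> x + \<zeta> \<bullet> (x' - x) - M * (norm (x' - x))\<^sup>2"
    using prox by (auto simp: proximal_subgradient_def)
  have "\<forall>\<^sub>F x' in nhds x. \<zeta> \<bullet> (x' - x) - M * (norm (x' - x))\<^sup>2 \<le> L * norm (x' - x)"
    using M lip by eventually_elim linarith
  moreover have "filterlim (\<lambda>\<tau>. x + \<tau> *\<^sub>R \<zeta>) (nhds x) (at_right 0)"
    by (rule tendsto_eq_intros tendsto_ident_at | simp)+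
  ultimately have "\<forall>\<^sub>F \<tau> in at_right 0.
      \<zeta> \<bullet> (\<tau> *\<^sub>R \<zeta>) - M * (norm (\<tau> *\<^sub>R \<zeta>))\<^sup>2 \<le> L * norm (\<tau> *\<^sub>R \<zeta>)"
    by (auto dest: eventually_compose_filterlim)
  then have ev: "\<forall>\<^sub>F \<tau> in at_right 0. norm \<zeta> - M * (\<tau> * norm \<zeta>) \<le> L"
    using eventually_at_right_less[of "0::real"]
  proof eventually_elim
    case (elim \<tau>)
    have "\<tau> * norm \<zeta> * (norm \<zeta> - M * (\<tau> * norm \<zeta>)) \<le> \<tau> * norm \<zeta> * L"
      using elim by (simp add: dot_square_norm power2_eq_square algebra_simps)
    then show ?case using elim False by simp
  qed
  have "((\<lambda>\<tau>. norm \<zeta> - M * (\<tau> * norm \<zeta>)) \<longlongrightarrow> norm \<zeta> - M * (0 * norm \<zeta>)) (at_right 0)"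
    by (intro tendsto_intros)
  then show ?thesis using tendsto_upperbound[OF _ ev] by simp
qed

text \<open>The proximal inequality for \<open>w \<bullet> F\<close> bounds the numerator of the quotient in the Frechet normal cone by
  \<open>M \<bar>x' - x\<bar>\<^sup>2\<close>, and the denominator is at least \<open>\<bar>x' - x\<bar>\<close>.\<close>
lemma scalarized_proximal_subgradient_normal:
  fixes F :: "'a::euclidean_space \<Rightarrow> 'b::euclidean_space"
  assumes "proximal_subgradient (\<lambda>x. w \<bullet> F x) x \<zeta>"
  shows "(\<zeta>, - w) \<in> frechet_normal_cone (x, F x) (range (\<lambda>x. (x, F x)))"
proof -
  let ?R = "range (\<lambda>x. (x, F x))"
  let ?q = "\<lambda>p. (\<zeta>, - w) \<bullet> (p - (x, F x)) / norm (p - (x, F x))"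
  obtain M where M: "\<forall>\<^sub>F x' in nhds x. w \<bullet> F x' \<ge> w \<bullet> F x + \<zeta> \<bullet> (x' - x) - M * (norm (x' - x))\<^sup>2"
    using assms by (auto simp: proximal_subgradient_def)
  have "Limsup (at (x, F x) within ?R) (\<lambda>p. ereal (?q p)) \<le> 0 + ereal e" if e: "e > 0" for e
  proof -
    have "((\<lambda>x'. M * norm (x' - x)) \<longlongrightarrow> M * norm (x - x)) (nhds x)"
      by (intro tendsto_intros filterlim_ident)
    then have "\<forall>\<^sub>F x' in nhds x. M * norm (x' - x) < e"
      using e by (auto dest: order_tendstoD(2))
    with M have "\<forall>\<^sub>F x' in nhds x. \<zeta> \<bullet> (x' - x) - w \<bullet> (F x' - F x) \<le> e * norm (x' - x)"
    proof eventually_elim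
      case (elim x')
      have "M * (norm (x' - x))\<^sup>2 = M * norm (x' - x) * norm (x' - x)"
        by (simp add: power2_eq_square)
      also have "\<dots> \<le> e * norm (x' - x)" using elim(2) by (intro mult_right_mono) auto
      finally show ?case using elim(1) by (simp add: inner_diff_right)
    qed
    moreover have "filterlim fst (nhds x) (at (x, F x) within ?R)"
      using tendsto_fst[OF tendsto_ident_at] by force
    ultimately have "\<forall>\<^sub>F p in at (x, F x) within ?R.
        \<zeta> \<bullet> (fst p - x) - w \<bullet> (F (fst p) - F x) \<le> e * norm (fst p - x)"
      by (auto dest: eventually_compose_filterlim)
    moreover have "\<forall>\<^sub>F p in at (x, F x) within ?R. p \<in> ?R \<and> p \<noteq> (x, F x)"
      by (auto simp: eventually_at_filter)
    ultimately have "\<forall>\<^sub>F p in at (x, F x) within ?R. ereal (?q p) \<le> 0 + ereal e"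
    proof eventually_elim
      case (elim p)
      then obtain x' where p: "p = (x', F x')" by auto
      have "norm (x' - x) \<le> norm (p - (x, F x))"
        using norm_fst_le[of "x' - x" "F x' - F x"] by (simp add: p)
      then have "e * norm (x' - x) \<le> e * norm (p - (x, F x))" using e by simp
      then have "(\<zeta>, - w) \<bullet> (p - (x, F x)) \<le> e * norm (p - (x, F x))"
        using elim(1) by (simp add: p)
      moreover have "norm (p - (x, F x)) > 0" using elim(2) by simp
      ultimately show ?case by (simp add: divide_le_eq)
    qed
    then show ?thesis by (rule Limsup_bounded)
  qed
  then show ?thesis
    unfolding frechet_normal_cone_def by (auto intro: ereal_le_epsilon2)
qed

section \<open>Proximal subgradients from growth along a line\<close>

text \<open>On the part of \<open>A\<close> where \<open>H\<close> is at most \<open>c\<close>, the penalty \<open>P\<close> never vanishes, so by compactness it is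
  bounded away from zero there, while \<open>H\<close> is bounded below; a large multiple of \<open>P\<close> makes up the
  difference.\<close>
lemma compact_exact_penalty:
  fixes H P :: "'a::metric_space \<Rightarrow> real"
  assumes A: "compact A" and H: "continuous_on A H" and P: "continuous_on A P"
    and P0: "\<And>x. x \<in> A \<Longrightarrow> P x \<ge> 0"
    and pos: "\<And>x. x \<in> A \<Longrightarrow> P x = 0 \<Longrightarrow> H x > c"
  obtains K where "K \<ge> 0" "\<And>x. x \<in> A \<Longrightarrow> H x + K * P x > c"
proof (cases "{x \<in> A. H x \<le> c} = {}")
  case True
  then have "H x + 0 * P x > c" if "x \<in> A" for x
    using that by force
  with that[of 0] show ?thesis by auto
next
  case False
  let ?B = "{x \<in> A. H x \<le> c}"
  have "closedin (top_of_set A) (A \<inter> H -` {..c})"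
    using H continuous_closedin_preimage closed_atMost by blast
  then have "compact (A \<inter> H -` {..c})"
    using A closedin_compact by blast
  moreover have "A \<inter> H -` {..c} = ?B" by auto
  ultimately have B: "compact ?B" by simp
  have "?B \<subseteq> A" by auto
  then have PB: "continuous_on ?B P" and HB: "continuous_on ?B H"
    using H P by (blast intro: continuous_on_subset)+
  obtain a where a: "a \<in> ?B" "\<And>x. x \<in> ?B \<Longrightarrow> P a \<le> P x"
    using continuous_attains_inf[OF B False PB] by blast
  obtain b where b: "b \<in> ?B" "\<And>x. x \<in> ?B \<Longrightarrow> H b \<le> H x"
    using continuous_attains_inf[OF B False HB] by blast
  have Pa: "P a > 0" using a(1) P0[of a] pos[of a] by force
  define K where "K = (c - H b) / P a + 1"
  have K: "K \<ge> 0" using b(1) Pa by (auto simp: K_def intro!: add_nonneg_nonneg divide_nonneg_pos)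
  moreover have "H x + K * P x > c" if "x \<in> A" for x
  proof (cases "x \<in> ?B")
    case True
    have "K * P a \<le> K * P x" using K a(2)[OF True] by (rule mult_left_mono[rotated])
    moreover have "K * P a = c - H b + P a" using Pa by (simp add: K_def field_simps)
    ultimately show ?thesis using b(2)[OF True] Pa by linarith
  next
    case False
    then have "H x > c" using that by simp
    moreover have "K * P x \<ge> 0" using K P0[OF that] by simp
    ultimately show ?thesis by linarith
  qed
  ultimately show ?thesis using that by blast
qed

text \<open>A parabola that supports \<open>\<theta>\<close> at \<open>y\<close> along the line in direction \<open>d\<close> only says something about the
  line. Bending the parabola slightly more makes \<open>y\<close> a strict minimizer on the line of the difference
  \<open>H\<close>; adding \<open>K\<close> times the squared distance to the line, with \<open>K\<close> large, then forces the minimizer over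
  a small ball around \<open>y\<close> into the interior of that ball. There the quadratic terms have a gradient,
  whose negative is a proximal subgradient of \<open>\<theta>\<close>. The penalty gradient is orthogonal to \<open>d\<close>, so the
  unknown size of \<open>K\<close> does not affect \<open>\<zeta> \<bullet> d\<close>.\<close>
lemma proximal_subgradient_near_line:
  fixes \<theta> :: "'a::euclidean_space \<Rightarrow> real"
  assumes cont: "continuous_on UNIV \<theta>" and d: "d \<noteq> 0" and \<delta>: "\<delta> > 0" and e: "e > 0"
    and touch: "\<And>s. \<bar>s\<bar> \<le> \<delta> \<Longrightarrow> \<theta> (y + s *\<^sub>R d) \<ge> \<theta> y + \<sigma> * s - C * s\<^sup>2"
  obtains x \<zeta> where "norm (x - y) < e" "proximal_subgradient \<theta> x \<zeta>" "\<bar>\<zeta> \<bullet> d - \<sigma>\<bar> < e"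
proof -
  \<comment> \<open>\<open>S u\<close> is the coordinate of \<open>u\<close> along \<open>d\<close>, and \<open>R u\<close> is the component orthogonal to \<open>d\<close>.\<close>
  define S where "S = (\<lambda>u. u \<bullet> d / (d \<bullet> d))"
  define R where "R = (\<lambda>u. u - S u *\<^sub>R d)"
  define C' where "C' = \<bar>C\<bar> + 1"
  have dd: "d \<bullet> d > 0" using d by simp
  have Sadd: "S (u + v) = S u + S v" and Radd: "R (u + v) = R u + R v" for u v
    by (auto simp: S_def R_def inner_add_left add_divide_distrib algebra_simps)
  have Rd: "R u \<bullet> d = 0" for u using dd by (simp add: R_def S_def inner_diff_left)
  have Sd: "S d = 1" using dd by (simp add: S_def)
  have Sle: "\<bar>S u\<bar> \<le> norm u / norm d" for u
  proof -
    have "\<bar>u \<bullet> d\<bar> \<le> norm u * norm d" by (rule Cauchy_Schwarz_ineq2)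
    then show ?thesis using d by (simp add: S_def dot_square_norm power2_eq_square field_simps)
  qed
  have pyth: "(norm u)\<^sup>2 = (S u)\<^sup>2 * (d \<bullet> d) + (norm (R u))\<^sup>2" for u
  proof -
    have "u = S u *\<^sub>R d + R u" by (simp add: R_def)
    then have "(norm u)\<^sup>2 = (S u *\<^sub>R d + R u) \<bullet> (S u *\<^sub>R d + R u)"
      by (metis power2_norm_eq_inner)
    also have "\<dots> = (S u)\<^sup>2 * (d \<bullet> d) + (norm (R u))\<^sup>2"
      using Rd[of u] by (simp add: inner_add_left inner_add_right inner_commute power2_eq_square[of "S u"] power2_norm_eq_inner)
    finally show ?thesis .
  qed
  have Rle: "(norm (R u))\<^sup>2 \<le> (norm u)\<^sup>2" for u
    using pyth[of u] dd by simp
  have contS: "continuous_on A (\<lambda>x. S (x - y))" and contR: "continuous_on A (\<lambda>x. R (x - y))" for A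
    unfolding R_def S_def by (intro continuous_intros; use dd in simp)+
  have contth: "continuous_on A \<theta>" for A using cont continuous_on_subset by blast
  \<comment> \<open>The radius \<open>\<eta>\<close> keeps \<open>S\<close> within the range \<open>\<delta>\<close> of the parabola and so small that the slope
    changes by at most \<open>e / 2\<close> between \<open>y\<close> and the minimizer.\<close>
  define \<tau> where "\<tau> = min \<delta> (e / (4 * C'))"
  define \<eta> where "\<eta> = min (e / 2) (norm d * \<tau>)"
  have C': "C' > 0" "C' > C" by (auto simp: C'_def)
  have \<tau>: "\<tau> > 0" using \<delta> e C' by (simp add: \<tau>_def)
  have \<eta>: "\<eta> > 0" "\<eta> < e" using e d \<tau> by (auto simp: \<eta>_def)
  have S\<tau>: "\<bar>S (x - y)\<bar> \<le> \<tau>" if "norm (x - y) \<le> \<eta>" for x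
  proof -
    have "norm (x - y) / norm d \<le> \<tau>" using that d by (simp add: \<eta>_def field_simps)
    then show ?thesis using Sle[of "x - y"] by linarith
  qed
  define H where "H = (\<lambda>x. \<theta> x - \<sigma> * S (x - y) + C' * (S (x - y))\<^sup>2)"
  have contH: "continuous_on A H" for A
    unfolding H_def by (intro continuous_intros contS contth)
  have contP: "continuous_on A (\<lambda>x. (norm (R (x - y)))\<^sup>2)" for A
    by (intro continuous_intros contR)
  \<comment> \<open>On the sphere, the penalty vanishes only at the two points of the line, where \<open>H\<close> exceeds its value
    at \<open>y\<close> because \<open>C'\<close> exceeds \<open>C\<close>.\<close>
  have onl: "H x > \<theta> y" if x: "x \<in> sphere y \<eta>" "(norm (R (x - y)))\<^sup>2 = 0" for x
  proof -
    let ?s = "S (x - y)"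
    have "R (x - y) = 0" using x by simp
    then have xs: "x = y + ?s *\<^sub>R d" by (simp add: R_def algebra_simps)
    have "?s \<noteq> 0" using xs x(1) \<eta> by auto
    have "\<bar>?s\<bar> \<le> \<delta>" using S\<tau>[of x] x by (simp add: \<tau>_def dist_norm norm_minus_commute)
    then have "\<theta> (y + ?s *\<^sub>R d) \<ge> \<theta> y + \<sigma> * ?s - C * ?s\<^sup>2" by (rule touch)
    then have "\<theta> x \<ge> \<theta> y + \<sigma> * ?s - C * ?s\<^sup>2" using xs by simp
    moreover have "C * ?s\<^sup>2 < C' * ?s\<^sup>2" using C' \<open>?s \<noteq> 0\<close> by simp
    ultimately show ?thesis unfolding H_def by linarith
  qed
  obtain K where K: "K \<ge> 0" "\<And>x. x \<in> sphere y \<eta> \<Longrightarrow> H x + K * (norm (R (x - y)))\<^sup>2 > \<theta> y"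
    using compact_exact_penalty[OF compact_sphere contH contP _ onl, of y \<eta>] by auto
  define G where "G = (\<lambda>x. H x + K * (norm (R (x - y)))\<^sup>2)"
  have "continuous_on (cball y \<eta>) G"
    unfolding G_def by (intro continuous_intros contH contR)
  then obtain x where x: "x \<in> cball y \<eta>" "\<And>x'. x' \<in> cball y \<eta> \<Longrightarrow> G x \<le> G x'"
    using continuous_attains_inf[OF compact_cball, of y \<eta> G] \<eta> by auto
  have "G y = \<theta> y" by (simp add: G_def H_def R_def S_def)
  then have "G x \<le> \<theta> y" using x(2)[of y] \<eta> by simp
  then have "x \<notin> sphere y \<eta>" using K(2)[of x] by (auto simp: G_def)
  then have xb: "x \<in> ball y \<eta>" using x(1) by auto
  \<comment> \<open>The negative gradient at \<open>x\<close> of the quadratic part of \<open>G\<close>.\<close>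
  define \<zeta> where "\<zeta> = ((\<sigma> - 2 * C' * S (x - y)) / (d \<bullet> d)) *\<^sub>R d - (2 * K) *\<^sub>R R (x - y)"
  have zd: "\<zeta> \<bullet> d = \<sigma> - 2 * C' * S (x - y)"
    using dd Rd by (simp add: \<zeta>_def inner_diff_left)
  have prox: "\<theta> x' \<ge> \<theta> x + \<zeta> \<bullet> (x' - x) - (C' / (d \<bullet> d) + K) * (norm (x' - x))\<^sup>2"
    if x': "x' \<in> ball y \<eta>" for x'
  proof -
    define u where "u = x' - x"
    have x'u: "x' - y = (x - y) + u" by (simp add: u_def)
    have Ru: "R (x - y) \<bullet> u = R (x - y) \<bullet> R u"
    proof -
      have "R u = u - S u *\<^sub>R d" by (simp only: R_def)
      then show ?thesis using Rd[of "x - y"] by (simp add: inner_diff_right)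
    qed
    have zu: "\<zeta> \<bullet> u = \<sigma> * S u - 2 * C' * S (x - y) * S u - 2 * K * (R (x - y) \<bullet> R u)"
    proof -
      have "\<zeta> \<bullet> u = (\<sigma> - 2 * C' * S (x - y)) * (u \<bullet> d / (d \<bullet> d)) - 2 * K * (R (x - y) \<bullet> u)"
        by (simp add: \<zeta>_def inner_diff_left inner_commute[of u d])
      also have "u \<bullet> d / (d \<bullet> d) = S u" by (simp only: S_def)
      finally show ?thesis by (simp add: Ru left_diff_distrib)
    qed
    have nR: "(norm (R (x - y) + R u))\<^sup>2 = (norm (R (x - y)))\<^sup>2 + 2 * (R (x - y) \<bullet> R u) + (norm (R u))\<^sup>2"
      by (simp add: inner_add_left inner_add_right inner_commute power2_norm_eq_inner)
    have "G x \<le> G x'" using x(2) x' by simp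
    then have "\<theta> x' \<ge> \<theta> x + \<zeta> \<bullet> u - C' * (S u)\<^sup>2 - K * (norm (R u))\<^sup>2"
      unfolding G_def H_def x'u Sadd Radd nR zu by (simp add: algebra_simps power2_eq_square)
    moreover have "C' * (S u)\<^sup>2 \<le> C' / (d \<bullet> d) * (norm u)\<^sup>2"
    proof -
      have "(S u)\<^sup>2 * (d \<bullet> d) \<le> (norm u)\<^sup>2" using pyth[of u] by simp
      then have "C' * ((S u)\<^sup>2 * (d \<bullet> d)) \<le> C' * (norm u)\<^sup>2" using C' by simp
      then show ?thesis using dd by (simp add: field_simps)
    qed
    moreover have "K * (norm (R u))\<^sup>2 \<le> K * (norm u)\<^sup>2"
      using K(1) Rle by (rule mult_left_mono[rotated])
    ultimately show ?thesis by (simp add: u_def distrib_right)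
  qed
  have "\<forall>\<^sub>F x' in nhds x. x' \<in> ball y \<eta>"
    using xb by (intro eventually_nhds_in_open) auto
  then have "proximal_subgradient \<theta> x \<zeta>"
    unfolding proximal_subgradient_def
    by (intro exI[of _ "C' / (d \<bullet> d) + K"]) (rule eventually_mono, assumption, rule prox)
  moreover have "norm (x - y) < e" using xb \<eta> by (simp add: dist_norm norm_minus_commute)
  moreover have "\<bar>\<zeta> \<bullet> d - \<sigma>\<bar> < e"
  proof -
    have "\<bar>S (x - y)\<bar> \<le> e / (4 * C')"
      using S\<tau>[of x] xb by (simp add: \<tau>_def dist_norm norm_minus_commute)
    then have "2 * C' * \<bar>S (x - y)\<bar> \<le> e / 2" using C' by (simp add: field_simps)
    then show ?thesis using zd e C' by (simp add: abs_mult)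
  qed
  ultimately show ?thesis using that by blast
qed

text \<open>Minimize \<open>r - p\<close> over the interval, where \<open>p s = e (sqrt (c s) - s)\<close>. This test function vanishes at both
  ends, has slope at least \<open>- e\<close> everywhere, and has infinite slope at \<open>0\<close>. The last property beats the
  linear growth of \<open>r\<close>, so near \<open>0\<close> the difference drops below \<open>r 0\<close>, which in turn is at most its
  value at either end: the minimizer \<open>y\<close> is interior. There \<open>r\<close> is supported by a translate of the concave
  function \<open>p\<close>, hence by a parabola with slope \<open>p' y\<close>. A minimizer of \<open>r\<close> plus a linear function could
  lie at the left end, as for \<open>r s = s\<close>.\<close>
lemma touching_parabola:
  fixes r :: "real \<Rightarrow> real"
  assumes c: "c > 0" and cont: "continuous_on {0..c} r" and le: "r 0 \<le> r c"
    and lip: "\<And>s. s \<in> {0..c} \<Longrightarrow> r s \<le> r 0 + L * s" and e: "e > 0"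
  obtains y \<sigma> C where "0 < y" "y < c" "\<sigma> \<ge> - e"
    "\<And>s. s \<in> {0..c} \<Longrightarrow> r s \<ge> r y + \<sigma> * (s - y) - C * (s - y)\<^sup>2"
proof -
  define a where "a = e * sqrt c"
  have a: "a > 0" using c e by (simp add: a_def)
  define q where "q = (\<lambda>s. r s - (a * sqrt s - e * s))"
  have "continuous_on {0..c} q" unfolding q_def by (intro continuous_intros cont)
  then obtain y where y: "y \<in> {0..c}" "\<And>s. s \<in> {0..c} \<Longrightarrow> q y \<le> q s"
    using continuous_attains_inf[of "{0..c}" q] c by auto
  \<comment> \<open>At \<open>\<tau>\<^sup>2\<close> the term \<open>a * sqrt s\<close> dominates the linear terms.\<close>
  define \<tau> where "\<tau> = min (sqrt c) (a / (2 * (\<bar>L\<bar> + e)))"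
  have \<tau>: "\<tau> > 0" using a c e by (auto simp: \<tau>_def intro!: divide_pos_pos)
  have "\<tau>\<^sup>2 \<le> c" using \<tau> c power_mono[of \<tau> "sqrt c" 2] by (simp add: \<tau>_def)
  then have \<tau>c: "\<tau>\<^sup>2 \<in> {0..c}" by simp
  have "(\<bar>L\<bar> + e) * \<tau> \<le> (\<bar>L\<bar> + e) * (a / (2 * (\<bar>L\<bar> + e)))"
    using e by (intro mult_left_mono) (auto simp: \<tau>_def)
  also have "\<dots> = a / 2"
  proof -
    have "\<bar>L\<bar> + e \<noteq> 0" using e by linarith
    then show ?thesis by (simp add: divide_simps)
  qed
  finally have "(\<bar>L\<bar> + e) * \<tau> < a" using a by linarith
  then have "(\<bar>L\<bar> + e) * \<tau> * \<tau> < a * \<tau>" using \<tau> by simp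
  then have "\<bar>L\<bar> * (\<tau> * \<tau>) + e * (\<tau> * \<tau>) < a * \<tau>" by (simp only: distrib_right mult.assoc)
  moreover have "L * (\<tau> * \<tau>) \<le> \<bar>L\<bar> * (\<tau> * \<tau>)" by (intro mult_right_mono) auto
  moreover have "r (\<tau> * \<tau>) \<le> r 0 + L * (\<tau> * \<tau>)" using lip[OF \<tau>c] by (simp only: power2_eq_square)
  moreover have "q (\<tau>\<^sup>2) = r (\<tau> * \<tau>) - a * \<tau> + e * (\<tau> * \<tau>)"
    using \<tau> by (simp add: q_def power2_eq_square)
  ultimately have "q (\<tau>\<^sup>2) < r 0" by linarith
  then have qy: "q y < r 0" using y(2)[OF \<tau>c] by simp
  have "q 0 = r 0" by (simp add: q_def)
  moreover have "q c = r c" using c by (simp add: q_def a_def)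
  ultimately have "y \<noteq> 0" "y \<noteq> c" using qy le by auto
  then have yy: "0 < y" "y < c" using y(1) by auto
  define b where "b = sqrt y"
  have b: "b > 0" "y = b\<^sup>2" using yy by (auto simp: b_def)
  show ?thesis
  proof (rule that[of y "a / (2 * b) - e" "a / (2 * b ^ 3)"])
    show "0 < y" "y < c" by fact+
    show "a / (2 * b) - e \<ge> - e" using a b by simp
    fix s assume s: "s \<in> {0..c}"
    define w where "w = sqrt s"
    have w: "w \<ge> 0" "s = w\<^sup>2" using s by (auto simp: w_def)
    \<comment> \<open>The Taylor expansion of the square root at \<open>y\<close> with an explicit lower bound for the remainder.\<close>
    have "w - b \<ge> (s - y) / (2 * b) - (s - y)\<^sup>2 / (2 * b ^ 3)"
    proof -
      have "(w - b)\<^sup>2 * b\<^sup>2 \<le> (w - b)\<^sup>2 * (w + b)\<^sup>2"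
        using b w by (intro mult_left_mono power_mono) auto
      also have "\<dots> = (s - y)\<^sup>2" by (simp add: w b(2) power2_eq_square algebra_simps)
      finally have "(w - b)\<^sup>2 * b\<^sup>2 / (2 * b ^ 3) \<le> (s - y)\<^sup>2 / (2 * b ^ 3)"
        using b by (intro divide_right_mono) auto
      moreover have "(w - b)\<^sup>2 * b\<^sup>2 / (2 * b ^ 3) = (s - y) / (2 * b) - (w - b)"
        using b by (simp add: w b(2) field_simps power2_eq_square power3_eq_cube)
      ultimately show ?thesis by linarith
    qed
    then have "a * (w - b) \<ge> a * ((s - y) / (2 * b) - (s - y)\<^sup>2 / (2 * b ^ 3))"
      using a by simp
    moreover have "r s - a * w + e * s \<ge> r y - a * b + e * y"
      using y(2)[OF s] by (simp add: q_def w_def b_def)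
    ultimately show "r s \<ge> r y + (a / (2 * b) - e) * (s - y) - a / (2 * b ^ 3) * (s - y)\<^sup>2"
      by (simp add: algebra_simps)
  qed
qed

section \<open>Quadratic growth and the limiting second-order subdifferential\<close>

text \<open>An approximate second-order Taylor inequality: the exact one would have \<open>d \<bullet> (Hessian) d\<close> in the
  place of \<open>\<zeta> \<bullet> d\<close>.\<close>
lemma second_order_mean_value_approx:
  fixes \<phi> :: "'a::euclidean_space \<Rightarrow> real"
  assumes \<phi>: "C11 \<phi>" and crit: "gradient \<phi> x = 0"
    and lip: "L-lipschitz_on (cball x r) (gradient \<phi>)"
    and t: "t > 0" "t * norm d \<le> r" and d: "d \<noteq> 0" and \<rho>: "\<rho> \<ge> 0" and e: "e > 0"
    and growth: "\<phi> (x + t *\<^sub>R d) \<ge> \<phi> x + \<rho> / 2 * (t * norm d)\<^sup>2"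
  obtains y \<zeta> where "norm (y - x) < t * norm d + e"
    "proximal_subgradient (\<lambda>z. d \<bullet> gradient \<phi> z) y \<zeta>"
    "\<zeta> \<bullet> d \<ge> \<rho> * (norm d)\<^sup>2 - e"
proof -
  let ?F = "gradient \<phi>"
  define N where "N = (norm d)\<^sup>2"
  define q where "q = (\<lambda>s. \<phi> (x + s *\<^sub>R d) - \<rho> / 2 * N * s\<^sup>2)"
  define p where "p = (\<lambda>s. d \<bullet> ?F (x + s *\<^sub>R d) - \<rho> * N * s)"
  have F: "continuous_on A ?F" for A using C11_continuous_gradient[OF \<phi>] continuous_on_subset by blast
  have q': "(q has_derivative (\<lambda>u. u * p s)) (at s)" for s
  proof -
    have "((\<lambda>s. x + s *\<^sub>R d) has_derivative (\<lambda>u. u *\<^sub>R d)) (at s)"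
      by (auto intro!: derivative_eq_intros)
    from has_derivative_compose[OF this C11_has_derivative[OF \<phi>]]
    have 1: "((\<lambda>s. \<phi> (x + s *\<^sub>R d)) has_derivative (\<lambda>u. ?F (x + s *\<^sub>R d) \<bullet> (u *\<^sub>R d))) (at s)" .
    have 2: "((\<lambda>s. \<rho> / 2 * N * s\<^sup>2) has_derivative (\<lambda>u. u * (\<rho> * N * s))) (at s)"
      by (auto intro!: derivative_eq_intros)
    show ?thesis
      using has_derivative_diff[OF 1 2] by (simp add: q_def p_def right_diff_distrib inner_commute)
  qed
  \<comment> \<open>Now \<open>p\<close>, the derivative of \<open>q\<close>, goes from \<open>0\<close> at \<open>0\<close> to a nonnegative value at \<open>c\<close>, so its own
    slope is nearly nonnegative somewhere in between.\<close>
  obtain c where c: "c \<in> {0<..<t}" "q t - q 0 = (t - 0) * p c"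
    using mvt_simple[OF t(1), of q "\<lambda>s u. u * p s"] q' has_derivative_at_withinI by blast
  have "q t \<ge> q 0" using growth by (simp add: q_def N_def power_mult_distrib mult_ac)
  then have pc: "p c \<ge> 0" using c(2) t(1) zero_le_mult_iff[of t "p c"] by simp
  have p0: "p 0 = 0" using crit by (simp add: p_def)
  have contp: "continuous_on A p" for A
  proof -
    have "continuous_on A (\<lambda>s. ?F (x + s *\<^sub>R d))"
      by (rule continuous_on_compose2[OF F[of UNIV]]) (auto intro!: continuous_intros)
    then show ?thesis unfolding p_def by (intro continuous_intros)
  qed
  have lipp: "p s \<le> p 0 + (L * N) * s" if s: "s \<in> {0..c}" for s
  proof -
    have nd: "norm (s *\<^sub>R d) = s * norm d" using s by simp
    have "s * norm d \<le> t * norm d" using s c by (intro mult_right_mono) auto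
    moreover have "0 \<le> s * norm d" using s by simp
    ultimately have "x + s *\<^sub>R d \<in> cball x r" "x \<in> cball x r"
      using t(2) nd by (auto simp: dist_norm)
    then have "norm (?F (x + s *\<^sub>R d)) \<le> L * (s * norm d)"
      using lipschitz_onD[OF lip, of "x + s *\<^sub>R d" x] crit s by (simp add: dist_norm)
    then have "norm d * norm (?F (x + s *\<^sub>R d)) \<le> norm d * (L * (s * norm d))"
      by (intro mult_left_mono) auto
    moreover have "d \<bullet> ?F (x + s *\<^sub>R d) \<le> norm d * norm (?F (x + s *\<^sub>R d))" by (rule norm_cauchy_schwarz)
    moreover have "\<rho> * N * s \<ge> 0" using \<rho> s by (simp add: N_def)
    ultimately show ?thesis by (simp add: p_def p0[unfolded p_def] crit N_def power2_eq_square mult_ac)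
  qed
  have "c > 0" "p 0 \<le> p c" "e / 2 > 0" using c pc p0 e by auto
  from touching_parabola[OF this(1) contp this(2) lipp this(3)]
  obtain y \<sigma> C where y: "0 < y" "y < c" and \<sigma>: "\<sigma> \<ge> - (e / 2)"
    and par: "\<And>s. s \<in> {0..c} \<Longrightarrow> p s \<ge> p y + \<sigma> * (s - y) - C * (s - y)\<^sup>2"
    by metis
  let ?\<theta> = "\<lambda>z. d \<bullet> ?F z"
  have touch: "?\<theta> (x + y *\<^sub>R d + s *\<^sub>R d) \<ge> ?\<theta> (x + y *\<^sub>R d) + (\<sigma> + \<rho> * N) * s - C * s\<^sup>2"
    if "\<bar>s\<bar> \<le> min y (c - y)" for s
  proof -
    have "p (y + s) \<ge> p y + \<sigma> * s - C * s\<^sup>2" using par[of "y + s"] that by (simp add: abs_le_iff)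
    moreover have "x + y *\<^sub>R d + s *\<^sub>R d = x + (y + s) *\<^sub>R d" by (simp add: scaleR_add_left)
    ultimately show ?thesis by (simp only: p_def distrib_left distrib_right)
  qed
  have "continuous_on UNIV ?\<theta>" by (intro continuous_intros F)
  moreover have "min y (c - y) > 0" using y by simp
  ultimately obtain z \<zeta> where z: "norm (z - (x + y *\<^sub>R d)) < e / 2" "proximal_subgradient ?\<theta> z \<zeta>"
      "\<bar>\<zeta> \<bullet> d - (\<sigma> + \<rho> * N)\<bar> < e / 2"
    using proximal_subgradient_near_line[OF _ d _ \<open>e / 2 > 0\<close> touch] by blast
  have "norm (z - x) \<le> norm (z - (x + y *\<^sub>R d)) + norm (y *\<^sub>R d)"
    using norm_triangle_ineq[of "z - (x + y *\<^sub>R d)" "y *\<^sub>R d"] by simp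
  moreover have "norm (y *\<^sub>R d) \<le> t * norm d" using y c by (simp add: mult_right_mono)
  ultimately have "norm (z - x) < t * norm d + e" using z(1) e by linarith
  moreover have "\<zeta> \<bullet> d \<ge> \<rho> * N - e" using z(3) \<sigma> by linarith
  ultimately show ?thesis using that z(2) unfolding N_def by blast
qed

text \<open>The coderivative is defined by limits of Frechet normals, so it suffices to find, for every \<open>e\<close>,
  a Frechet normal within \<open>e\<close> of the required base point and direction with \<open>\<zeta>\<close> bounded and \<open>\<zeta> \<bullet> d\<close>
  as large as required up to \<open>e\<close>.\<close>
lemma second_subdiff_selection:
  fixes \<phi> :: "'a::euclidean_space \<Rightarrow> real"
  assumes \<phi>: "C11 \<phi>" and crit: "gradient \<phi> x = 0"
    and t: "\<And>k::nat. 0 < t k" "t \<longlonglongrightarrow> 0" and w: "w \<longlonglongrightarrow> v" and v: "v \<noteq> 0" and \<rho>: "\<rho> \<ge> 0"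
    and growth: "\<forall>\<^sub>F k in sequentially. \<phi> (x + t k *\<^sub>R w k) \<ge> \<phi> x + \<rho> / 2 * (t k * norm (w k))\<^sup>2"
  obtains z where "z \<in> second_subdiff \<phi> x v" "z \<bullet> v \<ge> \<rho> * (norm v)\<^sup>2"
proof -
  let ?F = "gradient \<phi>"
  obtain r L where r: "r > 0" and lip: "L-lipschitz_on (cball x r) ?F"
    using \<phi> by (rule C11_local_lipschitz)
  have L: "L \<ge> 0" using lip by (rule lipschitz_on_nonneg)
  have step: "\<exists>y d \<zeta>. norm (y - x) < e \<and> norm (d - v) < e \<and> norm \<zeta> \<le> L * norm d \<and>
      (\<zeta>, - d) \<in> frechet_normal_cone (y, ?F y) (range (\<lambda>x. (x, ?F x))) \<and>
      \<zeta> \<bullet> d \<ge> \<rho> * (norm d)\<^sup>2 - e" if e: "e > 0" for e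
  proof -
    define e' where "e' = min e r / 2"
    have e': "e' > 0" "e' < e" "2 * e' \<le> r" "2 * e' \<le> e" using e r by (auto simp: e'_def)
    have "(\<lambda>k. t k * norm (w k)) \<longlonglongrightarrow> 0"
      using tendsto_mult[OF t(2) tendsto_norm[OF w]] by simp
    then have "\<forall>\<^sub>F k in sequentially. t k * norm (w k) < e'"
      using e' by (auto dest: order_tendstoD(2))
    moreover have "\<forall>\<^sub>F k in sequentially. norm (w k - v) < e"
      using tendstoD[OF w e] by (simp add: dist_norm)
    moreover have "\<forall>\<^sub>F k in sequentially. w k \<noteq> 0"
      using w v by (rule tendsto_imp_eventually_ne)
    ultimately have "\<forall>\<^sub>F k in sequentially. t k * norm (w k) < e' \<and> norm (w k - v) < e \<and> w k \<noteq> 0 \<and>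
        \<phi> (x + t k *\<^sub>R w k) \<ge> \<phi> x + \<rho> / 2 * (t k * norm (w k))\<^sup>2"
      using growth by eventually_elim blast
    then obtain k where k: "t k * norm (w k) < e'" "norm (w k - v) < e" "w k \<noteq> 0"
        "\<phi> (x + t k *\<^sub>R w k) \<ge> \<phi> x + \<rho> / 2 * (t k * norm (w k))\<^sup>2"
      using eventually_happens'[OF sequentially_bot] by blast
    let ?d = "w k"
    have "t k * norm ?d \<le> r" using k(1) e' by linarith
    from second_order_mean_value_approx[OF \<phi> crit lip t(1) this k(3) \<rho> e'(1) k(4)]
    obtain y \<zeta> where y: "norm (y - x) < t k * norm ?d + e'"
      "proximal_subgradient (\<lambda>z. ?d \<bullet> ?F z) y \<zeta>" "\<zeta> \<bullet> ?d \<ge> \<rho> * (norm ?d)\<^sup>2 - e'"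
      by blast
    have yx: "norm (y - x) < 2 * e'" using y(1) k(1) by linarith
    have yb: "y \<in> ball x r" using yx e' by (simp add: dist_norm norm_minus_commute)
    have "norm \<zeta> \<le> L * norm ?d"
    proof (rule proximal_subgradient_norm_le[OF y(2)])
      show "L * norm ?d \<ge> 0" using L by simp
      have "\<forall>\<^sub>F x' in nhds y. x' \<in> ball x r" using yb by (intro eventually_nhds_in_open) auto
      then show "\<forall>\<^sub>F x' in nhds y. ?d \<bullet> ?F x' \<le> ?d \<bullet> ?F y + L * norm ?d * norm (x' - y)"
      proof eventually_elim
        case (elim x')
        have "norm (?F x' - ?F y) \<le> L * norm (x' - y)"
          using lipschitz_onD[OF lip, of x' y] elim yb by (simp add: dist_norm)
        then have "norm ?d * norm (?F x' - ?F y) \<le> norm ?d * (L * norm (x' - y))"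
          by (intro mult_left_mono) auto
        moreover have "?d \<bullet> (?F x' - ?F y) \<le> norm ?d * norm (?F x' - ?F y)" by (rule norm_cauchy_schwarz)
        ultimately show ?case by (simp add: inner_diff_right mult_ac)
      qed
    qed
    moreover have "(\<zeta>, - ?d) \<in> frechet_normal_cone (y, ?F y) (range (\<lambda>x. (x, ?F x)))"
      using y(2) by (rule scalarized_proximal_subgradient_normal)
    moreover have "norm (y - x) < e" "\<zeta> \<bullet> ?d \<ge> \<rho> * (norm ?d)\<^sup>2 - e"
      using yx y(3) e' by linarith+
    ultimately show ?thesis using k(2) by blast
  qed
  define \<epsilon> where "\<epsilon> = (\<lambda>k. inverse (real (Suc k)))"
  have \<epsilon>: "\<epsilon> k > 0" for k by (simp add: \<epsilon>_def)
  have \<epsilon>0: "\<epsilon> \<longlonglongrightarrow> 0" unfolding \<epsilon>_def by (rule LIMSEQ_inverse_real_of_nat)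
  obtain Y D Z where Y: "\<And>k. norm (Y k - x) < \<epsilon> k" and D: "\<And>k. norm (D k - v) < \<epsilon> k"
    and Z: "\<And>k. norm (Z k) \<le> L * norm (D k)"
    and nor: "\<And>k. (Z k, - D k) \<in> frechet_normal_cone (Y k, ?F (Y k)) (range (\<lambda>x. (x, ?F x)))"
    and ZD: "\<And>k. Z k \<bullet> D k \<ge> \<rho> * (norm (D k))\<^sup>2 - \<epsilon> k"
  proof -
    have "\<forall>k. \<exists>y d \<zeta>. norm (y - x) < \<epsilon> k \<and> norm (d - v) < \<epsilon> k \<and> norm \<zeta> \<le> L * norm d \<and>
      (\<zeta>, - d) \<in> frechet_normal_cone (y, ?F y) (range (\<lambda>x. (x, ?F x))) \<and>
      \<zeta> \<bullet> d \<ge> \<rho> * (norm d)\<^sup>2 - \<epsilon> k"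
      using step[OF \<epsilon>] by blast
    from this[unfolded choice_iff] show ?thesis using that by blast
  qed
  have "(\<lambda>k. Y k - x) \<longlonglongrightarrow> 0"
    by (rule Lim_null_comparison[OF _ \<epsilon>0]) (use Y in \<open>auto intro: always_eventually less_imp_le\<close>)
  then have Yx: "Y \<longlonglongrightarrow> x" by (rule LIM_zero_cancel)
  have "(\<lambda>k. D k - v) \<longlonglongrightarrow> 0"
    by (rule Lim_null_comparison[OF _ \<epsilon>0]) (use D in \<open>auto intro: always_eventually less_imp_le\<close>)
  then have Dv: "D \<longlonglongrightarrow> v" by (rule LIM_zero_cancel)
  obtain B where B: "\<And>k. norm (D k) \<le> B"
    using convergent_imp_Bseq[of D] Dv by (auto simp: convergent_def Bseq_def)
  have "norm (Z k) \<le> L * B" for k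
    using Z[of k] mult_left_mono[OF B[of k] L] by linarith
  then have "bounded (range Z)" by (auto simp: bounded_iff)
  then obtain z s where s: "strict_mono (s :: nat \<Rightarrow> nat)" and Zz: "(Z \<circ> s) \<longlonglongrightarrow> z"
    using bounded_imp_convergent_subsequence by blast
  have Ys: "(Y \<circ> s) \<longlonglongrightarrow> x" and Ds: "(D \<circ> s) \<longlonglongrightarrow> v" and \<epsilon>s: "(\<epsilon> \<circ> s) \<longlonglongrightarrow> 0"
    using Yx Dv \<epsilon>0 s by (auto intro: LIMSEQ_subseq_LIMSEQ)
  have "isCont ?F x" using C11_continuous_gradient[OF \<phi>] by (simp add: continuous_on_eq_continuous_at)
  then have FY: "(\<lambda>k. ?F ((Y \<circ> s) k)) \<longlonglongrightarrow> ?F x" using Ys by (rule isCont_tendsto_compose)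
  have "z \<in> second_subdiff \<phi> x v"
    unfolding second_subdiff_def limiting_normal_cone_def mem_Collect_eq
  proof (intro exI conjI allI)
    show "(\<lambda>k. ((Y \<circ> s) k, ?F ((Y \<circ> s) k))) \<longlonglongrightarrow> (x, ?F x)" by (rule tendsto_Pair[OF Ys FY])
    show "(\<lambda>k. ((Z \<circ> s) k, - (D \<circ> s) k)) \<longlonglongrightarrow> (z, - v)"
      by (rule tendsto_Pair[OF Zz tendsto_minus[OF Ds]])
  qed (use nor in auto)
  moreover have "z \<bullet> v \<ge> \<rho> * (norm v)\<^sup>2"
  proof (rule tendsto_le[OF sequentially_bot])
    show "(\<lambda>k. (Z \<circ> s) k \<bullet> (D \<circ> s) k) \<longlonglongrightarrow> z \<bullet> v" by (rule tendsto_inner[OF Zz Ds])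
    show "(\<lambda>k. \<rho> * (norm ((D \<circ> s) k))\<^sup>2 - (\<epsilon> \<circ> s) k) \<longlonglongrightarrow> \<rho> * (norm v)\<^sup>2"
      using tendsto_diff[OF tendsto_mult[OF tendsto_const tendsto_power[OF tendsto_norm[OF Ds]]] \<epsilon>s, of \<rho> 2]
      by simp
  qed (use ZD in auto)
  ultimately show ?thesis using that by blast
qed

text \<open>Covers the direction \<open>0\<close>, for which \<open>second_subdiff_selection\<close> gives nothing.\<close>
lemma zero_in_second_subdiff: "0 \<in> second_subdiff \<phi> x 0"
proof -
  have "(0, 0) \<in> frechet_normal_cone (x, gradient \<phi> x) (range (\<lambda>x. (x, gradient \<phi> x)))"
    unfolding frechet_normal_cone_def by (auto intro!: Limsup_bounded always_eventually simp: inner_prod_def)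
  then show ?thesis
    unfolding second_subdiff_def limiting_normal_cone_def mem_Collect_eq
    by (intro exI[of _ "\<lambda>_. (x, gradient \<phi> x)"] exI[of _ "\<lambda>_. (0, 0)"]) auto
qed

section \<open>First-order conditions and multipliers\<close>

text \<open>If \<open>- c\<close> were outside the cone generated by the \<open>a i\<close> and the \<open>b j\<close> with both signs, a
  hyperplane would separate it from that cone, because finitely generated cones are closed; its
  normal vector would be an admissible \<open>v\<close> with \<open>c \<bullet> v < 0\<close>.\<close>
lemma farkas_mixed:
  fixes a b :: "'i \<Rightarrow> 'a::euclidean_space"
  assumes fin: "finite I" "finite J"
    and imp: "\<And>v. (\<And>i. i \<in> I \<Longrightarrow> a i \<bullet> v \<le> 0) \<Longrightarrow> (\<And>j. j \<in> J \<Longrightarrow> b j \<bullet> v = 0) \<Longrightarrow> c \<bullet> v \<ge> 0"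
  shows "\<exists>lam mu. (\<forall>i\<in>I. 0 \<le> lam i) \<and>
    c + (\<Sum>i\<in>I. lam i *\<^sub>R a i) + (\<Sum>j\<in>J. mu j *\<^sub>R b j) = 0"
proof -
  define comb where "comb = (\<lambda>lam mu. (\<Sum>i\<in>I. lam i *\<^sub>R a i) + (\<Sum>j\<in>J. mu j *\<^sub>R b j))"
  define K where "K = {comb lam mu | lam mu. \<forall>i\<in>I. lam i \<ge> 0}"
  define G where "G = a ` I \<union> (b ` J \<union> (\<lambda>j. - b j) ` J)"
  have combI: "comb lam mu \<in> K" if "\<And>i. i \<in> I \<Longrightarrow> lam i \<ge> 0" for lam mu
    using that unfolding K_def by blast
  have add: "comb l u + comb l' u' = comb (\<lambda>i. l i + l' i) (\<lambda>j. u j + u' j)" for l u l' u'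
    by (simp add: comb_def scaleR_add_left sum.distrib)
  have scale: "r *\<^sub>R comb l u = comb (\<lambda>i. r * l i) (\<lambda>j. r * u j)" for r l u
    by (simp add: comb_def scaleR_sum_right scaleR_add_right)
  have cone: "convex_cone K"
    unfolding convex_cone_iff
  proof (intro conjI ballI allI impI)
    fix x assume "x \<in> K"
    then obtain l u where x: "x = comb l u" "\<forall>i\<in>I. l i \<ge> 0" by (auto simp: K_def)
    show "x + y \<in> K" if "y \<in> K" for y
    proof -
      obtain l' u' where y: "y = comb l' u'" "\<forall>i\<in>I. l' i \<ge> 0" using \<open>y \<in> K\<close> by (auto simp: K_def)
      show ?thesis unfolding x(1) y(1) add using x(2) y(2) by (intro combI) simp
    qed
    show "r *\<^sub>R x \<in> K" if "r \<ge> 0" for r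
      unfolding x(1) scale using x(2) that by (intro combI) simp
  next
    show "0 \<in> K" using combI[of "\<lambda>_. 0" "\<lambda>_. 0"] by (simp add: comb_def)
  qed
  have "G \<subseteq> K"
  proof -
    have single: "(\<Sum>i\<in>A. (if i = k then r else 0) *\<^sub>R f i) = r *\<^sub>R f k"
      if "finite A" "k \<in> A" for A k and r :: real and f :: "'i \<Rightarrow> 'a"
    proof -
      have "(\<Sum>i\<in>A. (if i = k then r else 0) *\<^sub>R f i) = (\<Sum>i\<in>A. if i = k then r *\<^sub>R f k else 0)"
        by (rule sum.cong) auto
      then show ?thesis using that by simp
    qed
    have "a k \<in> K" if "k \<in> I" for k
      using combI[of "\<lambda>i. if i = k then 1 else 0" "\<lambda>_. 0"] single[OF fin(1) that, of 1 a]
      by (simp add: comb_def)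
    moreover have "b k \<in> K" "- b k \<in> K" if "k \<in> J" for k
      using combI[of "\<lambda>_. 0" "\<lambda>i. if i = k then 1 else 0"] single[OF fin(2) that, of 1 b]
        combI[of "\<lambda>_. 0" "\<lambda>i. if i = k then -1 else 0"] single[OF fin(2) that, of "-1" b]
      by (simp_all add: comb_def)
    ultimately show ?thesis by (auto simp: G_def)
  qed
  then have hull: "convex_cone hull G \<subseteq> K" using cone by (rule hull_minimal)
  have "- c \<in> convex_cone hull G"
  proof (rule ccontr)
    assume "- c \<notin> convex_cone hull G"
    moreover have "closed (convex_cone hull G)"
      using fin by (intro closed_convex_cone_hull) (simp add: G_def)
    ultimately have "\<exists>v \<beta>. v \<bullet> (- c) < \<beta> \<and> (\<forall>x\<in>convex_cone hull G. v \<bullet> x > \<beta>)"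
      by (intro separating_hyperplane_closed_point convex_convex_cone_hull)
    then obtain v \<beta> where v: "v \<bullet> (- c) < \<beta>" "\<And>x. x \<in> convex_cone hull G \<Longrightarrow> v \<bullet> x > \<beta>"
      by blast
    have \<beta>: "\<beta> < 0" using v(2)[OF convex_cone_hull_contains_0] by simp
    \<comment> \<open>Otherwise the multiple \<open>\<beta> / (v \<bullet> x)\<close> of \<open>x\<close>, which is in the cone, would lie on the
      separating hyperplane.\<close>
    have pos: "v \<bullet> x \<ge> 0" if "x \<in> G" for x
    proof (rule ccontr)
      assume n: "\<not> v \<bullet> x \<ge> 0"
      have "(\<beta> / (v \<bullet> x)) *\<^sub>R x \<in> convex_cone hull G"
        using that n \<beta> by (intro convex_cone_hull_mul hull_inc) (auto intro: divide_nonpos_neg)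
      from v(2)[OF this] n show False by simp
    qed
    have "c \<bullet> (- v) \<ge> 0"
    proof (rule imp)
      show "a i \<bullet> (- v) \<le> 0" if "i \<in> I" for i
        using pos[of "a i"] that by (simp add: G_def inner_commute)
      show "b j \<bullet> (- v) = 0" if "j \<in> J" for j
        using pos[of "b j"] pos[of "- b j"] that by (simp add: G_def inner_commute)
    qed
    then show False using v(1) \<beta> by (simp add: inner_commute)
  qed
  then have "- c \<in> K" using hull by blast
  then obtain lam mu where "\<forall>i\<in>I. lam i \<ge> 0" "- c = comb lam mu" unfolding K_def by blast
  then have "c + comb lam mu = 0" by (metis add.right_inverse)
  then have "c + (\<Sum>i\<in>I. lam i *\<^sub>R a i) + (\<Sum>j\<in>J. mu j *\<^sub>R b j) = 0"
    by (simp add: comb_def add.assoc)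
  then show ?thesis using \<open>\<forall>i\<in>I. lam i \<ge> 0\<close> by blast
qed

lemma directional_difference_quotient:
  fixes f :: "'a::euclidean_space \<Rightarrow> real"
  assumes d: "(f has_derivative f') (at x)"
    and t: "\<And>k. 0 < t k" "t \<longlonglongrightarrow> (0::real)" and w: "w \<longlonglongrightarrow> v"
  shows "(\<lambda>k. (f (x + t k *\<^sub>R w k) - f x) / t k) \<longlonglongrightarrow> f' v"
proof -
  have bl: "bounded_linear f'" using d by (rule has_derivative_bounded_linear)
  obtain B where B: "B > 0" "\<And>k. norm (w k) \<le> B"
    using convergent_imp_Bseq[of w] w by (auto simp: convergent_def Bseq_def)
  have tw: "(\<lambda>k. t k *\<^sub>R w k) \<longlonglongrightarrow> 0" using tendsto_scaleR[OF t(2) w] by simp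
  have "(\<lambda>k. (f (x + t k *\<^sub>R w k) - f x) / t k - f' (w k)) \<longlonglongrightarrow> 0"
  proof (rule LIMSEQ_I)
    fix e :: real assume e: "e > 0"
    have "e / (2 * B) > 0" using e B(1) by simp
    then obtain \<delta> where \<delta>: "\<delta> > 0"
      "\<And>y. norm (y - x) < \<delta> \<Longrightarrow> norm (f y - f x - f' (y - x)) \<le> e / (2 * B) * norm (y - x)"
      using d unfolding has_derivative_at_alt by blast
    obtain N where N: "\<And>k. k \<ge> N \<Longrightarrow> norm (t k *\<^sub>R w k) < \<delta>"
      using LIMSEQ_D[OF tw \<delta>(1)] by auto
    show "\<exists>N. \<forall>k\<ge>N. norm ((f (x + t k *\<^sub>R w k) - f x) / t k - f' (w k) - 0) < e"
    proof (intro exI allI impI)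
      fix k assume "k \<ge> N"
      have "f' (t k *\<^sub>R w k) = t k * f' (w k)"
        using linear_scale[OF bounded_linear.linear[OF bl]] by simp
      then have "\<bar>f (x + t k *\<^sub>R w k) - f x - t k * f' (w k)\<bar> \<le> e / (2 * B) * (t k * norm (w k))"
        using \<delta>(2)[of "x + t k *\<^sub>R w k"] N[OF \<open>k \<ge> N\<close>] t(1)[of k] by simp
      also have "\<dots> \<le> e / (2 * B) * (t k * B)"
        using e B t(1)[of k] by (intro mult_left_mono) auto
      also have "\<dots> = e / 2 * t k" using B by simp
      finally have "\<bar>f (x + t k *\<^sub>R w k) - f x - t k * f' (w k)\<bar> / t k \<le> e / 2"
        using t(1)[of k] by (simp add: pos_divide_le_eq)
      moreover have "(f (x + t k *\<^sub>R w k) - f x) / t k - f' (w k) = (f (x + t k *\<^sub>R w k) - f x - t k * f' (w k)) / t k"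
        using t(1)[of k] by (simp add: diff_divide_distrib)
      ultimately show "norm ((f (x + t k *\<^sub>R w k) - f x) / t k - f' (w k) - 0) < e"
        using e t(1)[of k] by (simp only: real_norm_def diff_zero abs_divide abs_of_pos)
    qed
  qed
  from tendsto_add[OF this bounded_linear.tendsto[OF bl w]] show ?thesis by simp
qed

lemma local_solution_contingent_nonneg:
  fixes f :: "'a::euclidean_space \<Rightarrow> real"
  assumes d: "(f has_derivative f') (at x)" and sol: "local_solution f X x"
    and v: "v \<in> contingent_cone x X"
  shows "f' v \<ge> 0"
proof -
  obtain t w where t: "\<And>k. 0 < t k" "t \<longlonglongrightarrow> (0::real)" and w: "w \<longlonglongrightarrow> v"
    and X: "\<And>k::nat. x + t k *\<^sub>R w k \<in> X"
    using v by (auto simp: contingent_cone_def)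
  obtain U where U: "open U" "x \<in> U" "\<And>y. y \<in> X \<inter> U \<Longrightarrow> f x \<le> f y"
    using sol by (auto simp: local_solution_def)
  have "(\<lambda>k. x + t k *\<^sub>R w k) \<longlonglongrightarrow> x" using tendsto_add[OF tendsto_const tendsto_scaleR[OF t(2) w], of x] by simp
  then have "\<forall>\<^sub>F k in sequentially. x + t k *\<^sub>R w k \<in> U" using U(1,2) by (rule topological_tendstoD)
  then have "\<forall>\<^sub>F k in sequentially. (f (x + t k *\<^sub>R w k) - f x) / t k \<ge> 0"
  proof eventually_elim
    case (elim k)
    then show ?case using U(3)[of "x + t k *\<^sub>R w k"] X[of k] t(1)[of k] by simp
  qed
  then show ?thesis
    by (rule tendsto_lowerbound[OF directional_difference_quotient[OF d t w]]) simp
qed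

text \<open>For active constraints the residuals at \<open>x + t v\<close> are \<open>o(t)\<close> by linearization; inactive ones stay
  negative. The subregularity estimate converts this into feasible points \<open>x + t w\<close> with \<open>w\<close> close to
  \<open>v\<close>.\<close>
lemma MSCQ_linearized_subset_contingent:
  fixes g h :: "nat \<Rightarrow> 'a::euclidean_space \<Rightarrow> real"
  assumes g: "\<And>i. i \<in> {1..m} \<Longrightarrow> (g i has_derivative (\<lambda>u. G i \<bullet> u)) (at x)"
    and h: "\<And>j. j \<in> {1..p} \<Longrightarrow> (h j has_derivative (\<lambda>u. H j \<bullet> u)) (at x)"
    and x: "x \<in> feasible_set m p g h" and mscq: "MSCQ m p g h x"
    and gv: "\<And>i. i \<in> active_set m g x \<Longrightarrow> G i \<bullet> v \<le> 0"
    and hv: "\<And>j. j \<in> {1..p} \<Longrightarrow> H j \<bullet> v = 0"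
  shows "v \<in> contingent_cone x (feasible_set m p g h)"
proof -
  let ?X = "feasible_set m p g h"
  obtain U \<kappa> where U: "open U" "x \<in> U" and \<kappa>: "\<kappa> > 0"
    and dist: "\<And>y. y \<in> U \<Longrightarrow> infdist y ?X
       \<le> \<kappa> * ((\<Sum>i\<in>{1..m}. max (g i y) 0) + (\<Sum>j\<in>{1..p}. \<bar>h j y\<bar>))"
    using mscq unfolding MSCQ_def by blast
  define T where "T = (\<lambda>k. inverse (real (Suc k)))"
  have T: "T k > 0" for k by (simp add: T_def)
  have T0: "T \<longlonglongrightarrow> 0" unfolding T_def by (rule LIMSEQ_inverse_real_of_nat)
  define X where "X = (\<lambda>k. x + T k *\<^sub>R v)"
  have Xx: "X \<longlonglongrightarrow> x"
    unfolding X_def using tendsto_add[OF tendsto_const tendsto_scaleR[OF T0 tendsto_const], of x v] by simp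
  have quot: "(\<lambda>k. (q (X k) - q x) / T k) \<longlonglongrightarrow> D \<bullet> v"
    if "(q has_derivative (\<lambda>u. D \<bullet> u)) (at x)" for q :: "'a \<Rightarrow> real" and D
    using directional_difference_quotient[OF that T T0 tendsto_const, of v] by (simp add: X_def)
  have gt: "(\<lambda>k. max (g i (X k)) 0 / T k) \<longlonglongrightarrow> 0" if i: "i \<in> {1..m}" for i
  proof (cases "i \<in> active_set m g x")
    case True
    then have "g i x = 0" by (simp add: active_set_def)
    then have "(\<lambda>k. max (g i (X k) / T k) 0) \<longlonglongrightarrow> max (G i \<bullet> v) 0"
      using tendsto_max[OF quot[OF g[OF i]] tendsto_const, of 0] by simp
    moreover have "max (g i (X k) / T k) 0 = max (g i (X k)) 0 / T k" for k
      using T[of k] by (auto simp: max_def divide_le_0_iff)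
    ultimately show ?thesis using gv[OF True] by simp
  next
    case False
    then have "g i x < 0" using i x by (force simp: active_set_def feasible_set_def)
    moreover have "(\<lambda>k. g i (X k)) \<longlonglongrightarrow> g i x"
      using has_derivative_continuous[OF g[OF i]] Xx by (rule isCont_tendsto_compose)
    ultimately have "\<forall>\<^sub>F k in sequentially. g i (X k) < 0" by (rule order_tendstoD(2)[rotated])
    then have "\<forall>\<^sub>F k in sequentially. max (g i (X k)) 0 / T k = 0"
      by eventually_elim simp
    then show ?thesis by (rule tendsto_eventually)
  qed
  have ht: "(\<lambda>k. \<bar>h j (X k)\<bar> / T k) \<longlonglongrightarrow> 0" if j: "j \<in> {1..p}" for j
  proof -
    have "h j x = 0" using j x by (simp add: feasible_set_def)
    then have "(\<lambda>k. h j (X k) / T k) \<longlonglongrightarrow> 0" using quot[OF h[OF j]] hv[OF j] by simp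
    moreover have "\<bar>T k\<bar> = T k" for k using T[of k] by simp
    ultimately show ?thesis using tendsto_rabs[of "\<lambda>k. h j (X k) / T k" 0] by simp
  qed
  define E where "E = (\<lambda>k. \<kappa> * ((\<Sum>i\<in>{1..m}. max (g i (X k)) 0 / T k) + (\<Sum>j\<in>{1..p}. \<bar>h j (X k)\<bar> / T k)))"
  have "E \<longlonglongrightarrow> \<kappa> * ((\<Sum>i\<in>{1..m}. 0) + (\<Sum>j\<in>{1..p}. 0))"
    unfolding E_def by (intro tendsto_intros gt ht)
  then have E0: "(\<lambda>k. E k + T k) \<longlonglongrightarrow> 0" using tendsto_add[OF _ T0] by force
  \<comment> \<open>Near-projections are enough: the slack \<open>T k * T k\<close> is still \<open>o(T k)\<close>.\<close>
  have "\<exists>y\<in>?X. dist (X k) y < infdist (X k) ?X + T k * T k" for k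
  proof -
    have "?X \<noteq> {}" using x by auto
    then have "(INF a\<in>?X. dist (X k) a) < infdist (X k) ?X + T k * T k"
      using T[of k] by (simp add: infdist_notempty)
    then show ?thesis using cINF_less_iff[OF \<open>?X \<noteq> {}\<close> bdd_below_image_dist] by blast
  qed
  then obtain Y where Y: "\<And>k. Y k \<in> ?X" "\<And>k. dist (X k) (Y k) < infdist (X k) ?X + T k * T k"
    by metis
  define W where "W = (\<lambda>k. (Y k - x) /\<^sub>R T k)"
  have "(\<lambda>k. W k - v) \<longlonglongrightarrow> 0"
  proof (rule Lim_null_comparison[OF _ E0])
    have "\<forall>\<^sub>F k in sequentially. X k \<in> U" using Xx U by (auto dest: topological_tendstoD)
    then show "\<forall>\<^sub>F k in sequentially. norm (W k - v) \<le> E k + T k"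
    proof eventually_elim
      case (elim k)
      have "infdist (X k) ?X \<le> T k * E k"
        using dist[OF elim] T[of k] by (simp add: E_def flip: sum_divide_distrib add_divide_distrib)
      then have "norm (Y k - X k) \<le> T k * (E k + T k)"
        using Y(2)[of k] by (simp add: dist_norm norm_minus_commute distrib_left)
      moreover have "W k - v = (Y k - X k) /\<^sub>R T k"
        using T[of k] by (simp add: W_def X_def algebra_simps)
      ultimately have "norm (W k - v) = norm (Y k - X k) / T k" using T[of k] by (simp add: divide_inverse mult.commute)
      also have "\<dots> \<le> E k + T k"
        using \<open>norm (Y k - X k) \<le> _\<close> T[of k] by (simp add: pos_divide_le_eq mult.commute)
      finally show ?case .
    qed
  qed
  then have "W \<longlonglongrightarrow> v" by (rule LIM_zero_cancel)
  moreover have "x + T k *\<^sub>R W k \<in> ?X" for k using Y(1)[of k] T[of k] by (simp add: W_def)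
  ultimately show ?thesis
    unfolding contingent_cone_def mem_Collect_eq
    by (intro exI[of _ T] exI[of _ W] conjI allI T T0)
qed

text \<open>Farkas' lemma is applied to the active constraints only; the multipliers of the others are
  set to \<open>0\<close>, which yields complementarity.\<close>
lemma multipliers_nonempty:
  fixes f :: "'a::euclidean_space \<Rightarrow> real"
  assumes f: "C11 f"
    and g: "\<And>i. i \<in> {1..m} \<Longrightarrow> C11 (g i)" and h: "\<And>j. j \<in> {1..p} \<Longrightarrow> C11 (h j)"
    and sol: "local_solution f (feasible_set m p g h) x" and mscq: "MSCQ m p g h x"
  shows "multipliers m p f g h x \<noteq> {}"
proof -
  let ?A = "active_set m g x"
  have A: "?A \<subseteq> {1..m}" by (auto simp: active_set_def)
  then have finA: "finite ?A" by (rule finite_subset) simp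
  have xX: "x \<in> feasible_set m p g h" using sol by (simp add: local_solution_def)
  have dual: "gradient f x \<bullet> v \<ge> 0"
    if "\<And>i. i \<in> ?A \<Longrightarrow> gradient (g i) x \<bullet> v \<le> 0" "\<And>j. j \<in> {1..p} \<Longrightarrow> gradient (h j) x \<bullet> v = 0" for v
  proof (rule local_solution_contingent_nonneg[OF C11_has_derivative[OF f] sol])
    show "v \<in> contingent_cone x (feasible_set m p g h)"
      by (rule MSCQ_linearized_subset_contingent[OF C11_has_derivative C11_has_derivative xX mscq])
         (fact g h that)+
  qed
  have "\<exists>lam mu. (\<forall>i\<in>?A. 0 \<le> lam i) \<and>
      gradient f x + (\<Sum>i\<in>?A. lam i *\<^sub>R gradient (g i) x) + (\<Sum>j\<in>{1..p}. mu j *\<^sub>R gradient (h j) x) = 0"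
    by (rule farkas_mixed[OF finA finite_atLeastAtMost]) (rule dual)
  then obtain lam mu where lam: "\<forall>i\<in>?A. 0 \<le> lam i"
    and stat: "gradient f x + (\<Sum>i\<in>?A. lam i *\<^sub>R gradient (g i) x) + (\<Sum>j\<in>{1..p}. mu j *\<^sub>R gradient (h j) x) = 0"
    by blast
  define lam' where "lam' = restrict (\<lambda>i. if i \<in> ?A then lam i else 0) {1..m}"
  define mu' where "mu' = restrict mu {1..p}"
  have "(\<Sum>i\<in>{1..m}. lam' i *\<^sub>R gradient (g i) x) = (\<Sum>i\<in>?A. lam i *\<^sub>R gradient (g i) x)"
    by (rule sum.mono_neutral_cong_right) (use A in \<open>auto simp: lam'_def\<close>)
  moreover have "(\<Sum>j\<in>{1..p}. mu' j *\<^sub>R gradient (h j) x) = (\<Sum>j\<in>{1..p}. mu j *\<^sub>R gradient (h j) x)"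
    by (rule sum.cong) (auto simp: mu'_def)
  ultimately have "gradient (\<lambda>x. lagrangian m p f g h x lam' mu') x = 0"
    using C11_lagrangian(2)[of f m g p h lam' mu' x] f g h stat by simp
  moreover have "lam' \<in> {1..m} \<rightarrow>\<^sub>E {0..}" "mu' \<in> {1..p} \<rightarrow>\<^sub>E UNIV"
    using lam by (auto simp: lam'_def mu'_def)
  moreover have "\<forall>i\<in>{1..m}. lam' i * g i x = 0" by (auto simp: lam'_def active_set_def)
  ultimately have "(lam', mu') \<in> multipliers m p f g h x" by (simp add: multipliers_def)
  then show ?thesis by blast
qed

section \<open>Second-order conditions on \<open>X0\<close>\<close>

lemma X0_set_subset_feasible: "X0_set m p g h x lam \<subseteq> feasible_set m p g h"
  by (force simp: X0_set_def feasible_set_def split: if_splits)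

text \<open>A positive \<open>lam i\<close> forces constraint \<open>i\<close> to be active at \<open>x\<close> by complementarity, and \<open>X0\<close> keeps
  such constraints at \<open>0\<close>.\<close>
lemma lagrangian_on_X0_set:
  assumes mult: "(lam, mu) \<in> multipliers m p f g h x" and y: "y \<in> X0_set m p g h x lam"
  shows "lagrangian m p f g h y lam mu = f y"
proof -
  have "lam i * g i y = 0" if i: "i \<in> {1..m}" for i
  proof (cases "lam i = 0")
    case False
    moreover have "lam i \<ge> 0" "lam i * g i x = 0" using mult i by (auto simp: multipliers_def)
    ultimately have "i \<in> active_set m g x \<and> lam i > 0" using i by (simp add: active_set_def)
    then show ?thesis using y i unfolding X0_set_def by auto
  qed simp
  then have "(\<Sum>i\<in>{1..m}. lam i * g i y) = 0" by (intro sum.neutral ballI)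
  moreover have "(\<Sum>j\<in>{1..p}. mu j * h j y) = 0" using y by (simp add: X0_set_def)
  ultimately show ?thesis by (simp add: lagrangian_def)
qed

lemma multipliers_base_in_X0_set:
  assumes "(lam, mu) \<in> multipliers m p f g h x" and "x \<in> feasible_set m p g h"
  shows "x \<in> X0_set m p g h x lam"
  using assms by (auto simp: multipliers_def X0_set_def feasible_set_def active_set_def)

text \<open>Local optimality and isolated local optimality of order 2 are the cases \<open>\<rho> = 0\<close> and \<open>\<rho> > 0\<close>.\<close>
lemma quadratic_growth_second_order:
  fixes f :: "'a::euclidean_space \<Rightarrow> real"
  assumes f: "C11 f"
    and g: "\<And>i. i \<in> {1..m} \<Longrightarrow> C11 (g i)" and h: "\<And>j. j \<in> {1..p} \<Longrightarrow> C11 (h j)"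
    and x: "x \<in> feasible_set m p g h"
    and U: "open U" "x \<in> U" and \<rho>: "\<rho> \<ge> 0"
    and growth: "\<And>y. y \<in> feasible_set m p g h \<inter> U \<Longrightarrow> f y \<ge> f x + \<rho> / 2 * (norm (y - x))\<^sup>2"
    and mult: "(lam, mu) \<in> multipliers m p f g h x"
    and v: "v \<in> contingent_cone x (X0_set m p g h x lam)" "v \<noteq> 0"
  shows "\<exists>z\<in>second_subdiff (\<lambda>x. lagrangian m p f g h x lam mu) x v. z \<bullet> v \<ge> \<rho> * (norm v)\<^sup>2"
proof -
  let ?X0 = "X0_set m p g h x lam"
  let ?\<phi> = "\<lambda>x. lagrangian m p f g h x lam mu"
  obtain t w where t: "\<And>k::nat. 0 < t k" "t \<longlonglongrightarrow> 0" and w: "w \<longlonglongrightarrow> v"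
    and X0: "\<And>k. x + t k *\<^sub>R w k \<in> ?X0"
    using v(1) unfolding contingent_cone_def by blast
  have \<phi>: "C11 ?\<phi>" using f g h by (rule C11_lagrangian(1))
  have crit: "gradient ?\<phi> x = 0" using mult by (simp add: multipliers_def)
  have \<phi>x: "?\<phi> x = f x" using mult multipliers_base_in_X0_set[OF mult x] by (rule lagrangian_on_X0_set)
  have "(\<lambda>k. x + t k *\<^sub>R w k) \<longlonglongrightarrow> x" using tendsto_add[OF tendsto_const tendsto_scaleR[OF t(2) w], of x] by simp
  then have "\<forall>\<^sub>F k in sequentially. x + t k *\<^sub>R w k \<in> U" using U by (auto dest: topological_tendstoD)
  then have "\<forall>\<^sub>F k in sequentially. ?\<phi> (x + t k *\<^sub>R w k) \<ge> ?\<phi> x + \<rho> / 2 * (t k * norm (w k))\<^sup>2"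
  proof eventually_elim
    case (elim k)
    have "f (x + t k *\<^sub>R w k) \<ge> f x + \<rho> / 2 * (norm (t k *\<^sub>R w k))\<^sup>2"
      using growth[of "x + t k *\<^sub>R w k"] elim subsetD[OF X0_set_subset_feasible X0[of k]] by simp
    moreover have "norm (t k *\<^sub>R w k) = t k * norm (w k)" using t(1)[of k] by simp
    ultimately show ?case by (simp only: \<phi>x lagrangian_on_X0_set[OF mult X0])
  qed
  from second_subdiff_selection[OF \<phi> crit t w v(2) \<rho> this] show ?thesis by blast
qed

theorem theorem3p5:
  fixes f :: "real ^ 'n \<Rightarrow> real"
    and g h :: "nat \<Rightarrow> real ^ 'n \<Rightarrow> real"
    and m p :: nat
    and xbar :: "real ^ 'n"
  assumes f_C11: "C11 f"
    and g_C11: "\<And>i. i \<in> {1..m} \<Longrightarrow> C11 (g i)"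
    and h_C11: "\<And>j. j \<in> {1..p} \<Longrightarrow> C11 (h j)"
    and sol: "local_solution f (feasible_set m p g h) xbar"
    and mscq: "MSCQ m p g h xbar"
  shows "((\<forall>v\<in>contingent_cone xbar (feasible_set m p g h). gradient f xbar \<bullet> v \<ge> 0) \<and>
          multipliers m p f g h xbar \<noteq> {}) \<and>
         (\<forall>(lam, mu)\<in>multipliers m p f g h xbar.
            \<forall>v\<in>contingent_cone xbar (X0_set m p g h xbar lam).
              \<exists>z\<in>second_subdiff (\<lambda>x. lagrangian m p f g h x lam mu) xbar v. z \<bullet> v \<ge> 0) \<and>
         (isolated_local_solution2 f (feasible_set m p g h) xbar \<longrightarrow>
          (\<forall>(lam, mu)\<in>multipliers m p f g h xbar.
            \<forall>v\<in>contingent_cone xbar (X0_set m p g h xbar lam) - {0}.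
              \<exists>z\<in>second_subdiff (\<lambda>x. lagrangian m p f g h x lam mu) xbar v. z \<bullet> v > 0))"
proof (intro conjI impI)
  let ?X = "feasible_set m p g h"
  have xX: "xbar \<in> ?X" using sol by (simp add: local_solution_def)
  have growth: "\<exists>z\<in>second_subdiff (\<lambda>x. lagrangian m p f g h x lam mu) xbar v. z \<bullet> v \<ge> \<rho> * (norm v)\<^sup>2"
    if "open U" "xbar \<in> U" "\<rho> \<ge> 0"
      "\<And>y. y \<in> ?X \<inter> U \<Longrightarrow> f y \<ge> f xbar + \<rho> / 2 * (norm (y - xbar))\<^sup>2"
      "(lam, mu) \<in> multipliers m p f g h xbar"
      "v \<in> contingent_cone xbar (X0_set m p g h xbar lam)" "v \<noteq> 0" for U \<rho> lam mu v
    using f_C11 g_C11 h_C11 xX that by (rule quadratic_growth_second_order)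
  show "\<forall>v\<in>contingent_cone xbar ?X. gradient f xbar \<bullet> v \<ge> 0"
    using local_solution_contingent_nonneg[OF C11_has_derivative[OF f_C11] sol] by blast
  show "multipliers m p f g h xbar \<noteq> {}"
    using f_C11 g_C11 h_C11 sol mscq by (rule multipliers_nonempty)
  have "\<exists>z\<in>second_subdiff (\<lambda>x. lagrangian m p f g h x lam mu) xbar v. z \<bullet> v \<ge> 0"
    if mult: "(lam, mu) \<in> multipliers m p f g h xbar"
      and v: "v \<in> contingent_cone xbar (X0_set m p g h xbar lam)" for lam mu v
  proof -
    obtain U where U: "open U" "xbar \<in> U" "\<And>y. y \<in> ?X \<inter> U \<Longrightarrow> f xbar \<le> f y"
      using sol unfolding local_solution_def by blast
    show "\<exists>z\<in>second_subdiff (\<lambda>x. lagrangian m p f g h x lam mu) xbar v. z \<bullet> v \<ge> 0"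
    proof (cases "v = 0")
      case True
      then show ?thesis using zero_in_second_subdiff by force
    next
      case False
      have "f y \<ge> f xbar + 0 / 2 * (norm (y - xbar))\<^sup>2" if "y \<in> ?X \<inter> U" for y
        using U(3)[OF that] by simp
      from growth[OF U(1,2) order_refl this mult v False] show ?thesis by simp
    qed
  qed
  then show "\<forall>(lam, mu)\<in>multipliers m p f g h xbar.
            \<forall>v\<in>contingent_cone xbar (X0_set m p g h xbar lam).
              \<exists>z\<in>second_subdiff (\<lambda>x. lagrangian m p f g h x lam mu) xbar v. z \<bullet> v \<ge> 0"
    by blast
  assume "isolated_local_solution2 f ?X xbar"
  then obtain \<rho> U where \<rho>: "\<rho> > 0" and U: "open U" "xbar \<in> U"
    and iso: "\<And>y. y \<in> ?X \<inter> U \<Longrightarrow> y \<noteq> xbar \<Longrightarrow> f y > f xbar + 1/2 * \<rho> * (norm (y - xbar))\<^sup>2"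
    unfolding isolated_local_solution2_def by blast
  have gr: "f y \<ge> f xbar + \<rho> / 2 * (norm (y - xbar))\<^sup>2" if "y \<in> ?X \<inter> U" for y
    using iso[OF that] by (cases "y = xbar") auto
  have "\<exists>z\<in>second_subdiff (\<lambda>x. lagrangian m p f g h x lam mu) xbar v. z \<bullet> v > 0"
    if mult: "(lam, mu) \<in> multipliers m p f g h xbar"
      and v: "v \<in> contingent_cone xbar (X0_set m p g h xbar lam)" "v \<noteq> 0" for lam mu v
  proof -
    obtain z where z: "z \<in> second_subdiff (\<lambda>x. lagrangian m p f g h x lam mu) xbar v"
      "z \<bullet> v \<ge> \<rho> * (norm v)\<^sup>2"
      using growth[OF U less_imp_le[OF \<rho>] gr mult v] by blast
    moreover have "\<rho> * (norm v)\<^sup>2 > 0" using \<rho> v(2) by simp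
    ultimately show ?thesis by force
  qed
  then show "\<forall>(lam, mu)\<in>multipliers m p f g h xbar.
            \<forall>v\<in>contingent_cone xbar (X0_set m p g h xbar lam) - {0}.
              \<exists>z\<in>second_subdiff (\<lambda>x. lagrangian m p f g h x lam mu) xbar v. z \<bullet> v > 0"
    by blast
qed

end
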